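(* Let $\bar m(n)$ be a sequence such that $$ n\log n \ll \bar m(n) \ll 2^n(\log n)^{-1}, $$ and let $A_n\subset\mathcal V_n$ be a sequence of percolation clouds on $\mathcal V_n$ with densities $\bar m(n)^{-1}$, defined on a common probability space $(\Omega,F,P)$. Then, for all $a>0$, $$\lim_{n\to\infty}\max_{x\in\mathcal V_n}\Big|\mathbb P_x\big[H_n(A_n\setminus x)\ge a\,\bar m(n)\big]-e^{-a}\Big|=0,\qquad P\text{-a.s.}$$
   Context: $\mathcal V_n=\{0,1\}^n$ is the $n$-dimensional hypercube with metric $d(x,y)=\sum_{i=1}^n \mathbf 1\{x(i)\ne y(i)\}$. $Y_n$ is the discrete-time simple random walk on $\mathcal V_n$: it has transition probabilities $\mathbb P[Y_n(k+1)=y\mid Y_n(k)=x]=n^{-1}$ if $d(x,y)=1$ and $0$ otherwise; $\mathbb P_x$ is its law conditioned on $Y_n(0)=x$. For $A\subset\mathcal V_n$, the hitting time is $H_n(A)=\min\{k\ge 0: Y_n(k)\in A\}$ (with $\min\emptyset=\infty$). $A\setminus x$ means $A\setminus\{x\}$. A random set $A\subset\mathcal V_n$ is a percolation cloud with density $\rho\in[0,1]$ if each site $x\in\mathcal V_n$ belongs to $A$ with probability $\rho$ independently of all other sites. The walk is independent of the random sets, i.e. $\mathbb P_x$ is the law of the walk for a fixed realisation of $A_n$. For positive sequences, $u(n)\ll v(n)$ means $u(n)/v(n)\to0$ as $n\to\infty$. *)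

theory Defs
  imports "HOL-Probability.Probability"
begin

text \<open>Points of the hypercube are Boolean lists, so that all dimensions share one type.\<close>

definition hypercube :: "nat \<Rightarrow> bool list set" where
  "hypercube n = {x. length x = n}"

definition hamming_dist :: "nat \<Rightarrow> bool list \<Rightarrow> bool list \<Rightarrow> nat" where
  "hamming_dist n x y = (\<Sum>i<n. of_bool (x ! i \<noteq> y ! i))"

text \<open>
  \<open>M\<close> plays the role of the law \<open>\<bbbP>\<^sub>x\<close> and \<open>Y k\<close> is the position at time \<open>k\<close>.
  The Markov property and the transition probabilities are stated together, by conditioning
  on the whole past; pasts of probability zero are excluded because \<open>cond_prob\<close> is 0 there.
  No such process exists for \<open>n = 0\<close>.
\<close>

locale simple_random_walk = prob_space M for M :: "'w measure" +
  fixes n :: nat and Y :: "nat \<Rightarrow> 'w \<Rightarrow> bool list" and x :: "bool list"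
  assumes position_measurable: "\<And>k. Y k \<in> measurable M (count_space (hypercube n))"
    and start: "\<P>(\<omega> in M. Y 0 \<omega> = x) = 1"
    and transition:
      "\<And>k z y. \<P>(\<omega> in M. \<forall>i\<le>k. Y i \<omega> = z i) > 0 \<Longrightarrow> y \<in> hypercube n \<Longrightarrow>
         \<P>(\<omega> in M. Y (Suc k) \<omega> = y \<bar> \<forall>i\<le>k. Y i \<omega> = z i) =
           (if hamming_dist n (z k) y = 1 then 1 / real n else 0)"

text \<open>The infimum of the empty set in \<open>enat\<close> is \<open>\<infinity>\<close>.\<close>

definition hitting_time :: "(nat \<Rightarrow> 'w \<Rightarrow> 'v) \<Rightarrow> 'v set \<Rightarrow> 'w \<Rightarrow> enat" where
  "hitting_time Y B \<omega> = (INF k \<in> {k. Y k \<omega> \<in> B}. enat k)"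

text \<open>\<open>indep_events\<close> includes the measurability of the events.\<close>

locale percolation_cloud = prob_space M for M :: "'w measure" +
  fixes n :: nat and \<rho> :: real and A :: "'w \<Rightarrow> bool list set"
  assumes density: "0 \<le> \<rho>" "\<rho> \<le> 1"
    and subset: "\<And>\<omega>. \<omega> \<in> space M \<Longrightarrow> A \<omega> \<subseteq> hypercube n"
    and site_prob: "\<And>x. x \<in> hypercube n \<Longrightarrow> \<P>(\<omega> in M. x \<in> A \<omega>) = \<rho>"
    and sites_indep: "indep_events (\<lambda>x. {\<omega> \<in> space M. x \<in> A \<omega>}) (hypercube n)"

end

theory Submission
  imports Defs
begin

text \<open>
  The walk needs about \<open>n ln n\<close> steps to forget its starting point, which is little compared with the time
  \<open>m n\<close> at which it meets a set of density \<open>1 / m n\<close>. In a block of \<open>\<delta> * m n\<close> steps, with \<open>\<delta>\<close> small, the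
  expected number of visits to the set is therefore about \<open>\<delta>\<close> from every starting point, provided that no
  starting point expects many visits before the walk has mixed. Under the same proviso a walk that has
  just visited the set expects only about \<open>\<delta>\<close> further visits in the block, so the probability of at least
  one visit lies between \<open>\<delta> / (1 + \<delta>)\<close> and \<open>\<delta>\<close>, up to small errors. These bounds hold uniformly in the
  position at the beginning of the block and hence multiply over \<open>K = a/\<delta>\<close> consecutive blocks
  (\<open>avoid_block_bounds\<close>): the probability of no visit in \<open>a * m n\<close> steps lies between \<open>(1 - a/K)\<^sup>K\<close> and
  \<open>(1 + a/K) powr (- K)\<close>, and both bounds tend to \<open>exp (- a)\<close> as \<open>K\<close> grows (\<open>avoid_limit\<close>).

  Mixing is read off the spectral decomposition of the walk in Walsh functions. Because of the parity of
  the walk, it is stated for the sum of two consecutive transition probabilities (\<open>trans_prob_pair\<close>).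
  After mixing, the expected number of visits depends on the size of the set alone (\<open>visits_bounds\<close>).

  What remains is to show that almost every realisation of the clouds has the right size and no clusters
  (\<open>cloud_almost_surely_regular\<close>). As the joint law of the clouds in different dimensions is arbitrary,
  this takes Chernoff bounds that are summable over the dimension. The size has mean
  \<open>2\<^sup>n / m n\<close>, which is large compared with \<open>ln n\<close>, so the probability of a deviation is summable. For the
  visits before mixing one needs a bound that survives a union over \<open>2\<^sup>n\<close> starting points. It is available
  because a single site is visited at most \<open>4325 / n\<close> times in expectation during the times
  \<open>1, \<dots>, n\<^sup>2\<close> (\<open>sum_trans_prob_short\<close>): exponential moments of order \<open>n\<close> of the number of visits to the
  cloud stay under control, and the probability of a cluster at a given starting point is at most
  \<open>exp (- 2n)\<close> for large \<open>n\<close> (\<open>prob_many_visits\<close>).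
\<close>

section \<open>Flipping coordinates and averaging over neighbours\<close>

definition flip :: "nat \<Rightarrow> bool list \<Rightarrow> bool list" where
  "flip i x = x[i := \<not> x ! i]"

definition neighbour_mean :: "nat \<Rightarrow> (bool list \<Rightarrow> real) \<Rightarrow> bool list \<Rightarrow> real" where
  "neighbour_mean n f x = (\<Sum>i<n. f (flip i x)) / real n"

lemma finite_hypercube [simp]: "finite (hypercube n)"
  unfolding hypercube_def using finite_lists_length_eq[of "UNIV :: bool set" n] by simp

lemma card_hypercube: "card (hypercube n) = 2 ^ n"
  unfolding hypercube_def using card_lists_length_eq[of "UNIV :: bool set" n] by simp

lemma hypercube_nonempty: "hypercube n \<noteq> {}"
  using card_hypercube[of n] by force

lemma flip_in_hypercube [simp]: "flip i x \<in> hypercube n \<longleftrightarrow> x \<in> hypercube n"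
  by (simp add: flip_def hypercube_def)

lemma flip_nth: "x \<in> hypercube n \<Longrightarrow> i < n \<Longrightarrow> j < n \<Longrightarrow>
    flip i x ! j = (if j = i then \<not> x ! j else x ! j)"
  by (auto simp: flip_def hypercube_def nth_list_update)

lemma hypercube_eqI: "x \<in> hypercube n \<Longrightarrow> y \<in> hypercube n \<Longrightarrow> (\<And>i. i < n \<Longrightarrow> x ! i = y ! i) \<Longrightarrow> x = y"
  by (auto simp: hypercube_def intro: nth_equalityI)

lemma inj_on_flip: "x \<in> hypercube n \<Longrightarrow> inj_on (\<lambda>i. flip i x) {..<n}"
  by (rule inj_onI) (metis flip_nth lessThan_iff)

lemma neighbours_eq_flips:
  assumes x: "x \<in> hypercube n"
  shows "{y \<in> hypercube n. hamming_dist n x y = 1} = (\<lambda>i. flip i x) ` {..<n}"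
proof (intro equalityI subsetI)
  fix y assume "y \<in> {y \<in> hypercube n. hamming_dist n x y = 1}"
  then have y: "y \<in> hypercube n" and d: "hamming_dist n x y = 1" by auto
  have "(\<Sum>i<n. of_bool (x ! i \<noteq> y ! i)) = card {i. i < n \<and> x ! i \<noteq> y ! i}"
    by (subst sum.mono_neutral_cong_right[where S = "{i. i < n \<and> x ! i \<noteq> y ! i}" and h = "\<lambda>_. 1"]) auto
  with d have "card {i. i < n \<and> x ! i \<noteq> y ! i} = 1"
    by (simp add: hamming_dist_def)
  then obtain i where i: "{i. i < n \<and> x ! i \<noteq> y ! i} = {i}"
    by (auto simp: card_1_singleton_iff)
  then have "i < n" "\<And>j. j < n \<Longrightarrow> x ! j \<noteq> y ! j \<longleftrightarrow> j = i" by auto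
  then have "y = flip i x"
    using x y by (intro hypercube_eqI[of _ n]) (auto simp: flip_nth)
  with \<open>i < n\<close> show "y \<in> (\<lambda>i. flip i x) ` {..<n}" by auto
next
  fix y assume "y \<in> (\<lambda>i. flip i x) ` {..<n}"
  then obtain i where i: "i < n" "y = flip i x" by auto
  have "hamming_dist n x y = (\<Sum>j<n. if j = i then 1 else 0)"
    unfolding hamming_dist_def using i x by (intro sum.cong) (auto simp: flip_nth)
  with i x show "y \<in> {y \<in> hypercube n. hamming_dist n x y = 1}" by simp
qed

lemma sum_flips_eq_sum_neighbours:
  assumes x: "x \<in> hypercube n"
  shows "(\<Sum>i<n. f (flip i x)) = (\<Sum>y\<in>{y \<in> hypercube n. hamming_dist n x y = 1}. f y)"
  unfolding neighbours_eq_flips[OF x] by (simp add: sum.reindex[OF inj_on_flip[OF x]])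

lemma neighbour_mean_mono:
  assumes "\<And>i. i < n \<Longrightarrow> f (flip i x) \<le> g (flip i x)"
  shows "neighbour_mean n f x \<le> neighbour_mean n g x"
  unfolding neighbour_mean_def using assms by (intro divide_right_mono sum_mono) auto

lemma neighbour_mean_cong:
  "(\<And>i. i < n \<Longrightarrow> f (flip i x) = g (flip i x)) \<Longrightarrow> neighbour_mean n f x = neighbour_mean n g x"
  by (simp add: neighbour_mean_def)

lemma neighbour_mean_const: "n \<ge> 1 \<Longrightarrow> neighbour_mean n (\<lambda>_. c) x = c"
  by (simp add: neighbour_mean_def)

lemma neighbour_mean_diff:
  "neighbour_mean n (\<lambda>z. f z - g z) x = neighbour_mean n f x - neighbour_mean n g x"
  by (simp add: neighbour_mean_def sum_subtractf diff_divide_distrib)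

lemma neighbour_mean_cmult: "neighbour_mean n (\<lambda>z. c * f z) x = c * neighbour_mean n f x"
  by (simp add: neighbour_mean_def sum_distrib_left)

lemma neighbour_mean_sum:
  "neighbour_mean n (\<lambda>z. \<Sum>y\<in>B. f y z) x = (\<Sum>y\<in>B. neighbour_mean n (f y) x)"
  unfolding neighbour_mean_def by (subst sum.swap) (simp add: sum_divide_distrib)

section \<open>Avoidance probabilities and expected visits\<close>

primrec trans_prob :: "nat \<Rightarrow> nat \<Rightarrow> bool list \<Rightarrow> bool list \<Rightarrow> real" where
  "trans_prob n 0 x y = of_bool (x = y)"
| "trans_prob n (Suc k) x y = neighbour_mean n (\<lambda>z. trans_prob n k z y) x"

text \<open>
  The times that count are \<open>1, \<dots>, k\<close> in both \<open>avoid\<close> and \<open>visits\<close>: time \<open>0\<close> is left out, so that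
  blocks of time can be concatenated without asking whether the walk stands in \<open>B\<close> where one block
  ends and the next begins.
\<close>

primrec avoid :: "nat \<Rightarrow> bool list set \<Rightarrow> nat \<Rightarrow> bool list \<Rightarrow> real" where
  "avoid n B 0 x = 1"
| "avoid n B (Suc k) x = neighbour_mean n (\<lambda>z. if z \<in> B then 0 else avoid n B k z) x"

definition visits :: "nat \<Rightarrow> bool list set \<Rightarrow> nat \<Rightarrow> bool list \<Rightarrow> real" where
  "visits n B k x = (\<Sum>y\<in>B. \<Sum>j=1..k. trans_prob n j x y)"

lemma trans_prob_nonneg: "trans_prob n k x y \<ge> 0"
proof (induction k arbitrary: x)
  case (Suc k)
  then show ?case by (auto simp: neighbour_mean_def intro!: divide_nonneg_nonneg sum_nonneg)
qed simp

lemma sum_trans_prob: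
  assumes "n \<ge> 1" "x \<in> hypercube n"
  shows "(\<Sum>y\<in>hypercube n. trans_prob n k x y) = 1"
  using assms(2)
proof (induction k arbitrary: x)
  case 0
  then show ?case by (simp add: of_bool_def)
next
  case (Suc k)
  have "(\<Sum>y\<in>hypercube n. trans_prob n (Suc k) x y)
      = neighbour_mean n (\<lambda>z. \<Sum>y\<in>hypercube n. trans_prob n k z y) x"
    by (simp add: neighbour_mean_sum)
  also have "\<dots> = neighbour_mean n (\<lambda>_. 1) x"
    using Suc by (intro neighbour_mean_cong) simp
  finally show ?case using assms(1) by (simp add: neighbour_mean_const)
qed

text \<open>One step from any point reaches \<open>y\<close> with probability at most \<open>1/n\<close>, and averaging over neighbours
  preserves an upper bound that holds at all points.\<close>

lemma trans_prob_Suc_le: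
  assumes "n \<ge> 1" "x \<in> hypercube n"
  shows "trans_prob n (Suc k) x y \<le> 1 / n"
  using assms(2)
proof (induction k arbitrary: x)
  case 0
  have "(\<Sum>i<n. of_bool (flip i x = y)) = real (card {i \<in> {..<n}. flip i x = y})"
    by (simp add: of_bool_def flip: sum.inter_filter)
  also have "card {i \<in> {..<n}. flip i x = y} \<le> card {y}"
    using inj_on_flip[OF 0] by (intro card_inj_on_le[where f = "\<lambda>i. flip i x"]) (auto simp: inj_on_def)
  finally show ?case
    by (simp add: neighbour_mean_def divide_right_mono)
next
  case (Suc k)
  have "trans_prob n (Suc (Suc k)) x y \<le> neighbour_mean n (\<lambda>_. 1 / n) x"
    unfolding trans_prob.simps(2)[of n "Suc k"] using Suc by (intro neighbour_mean_mono) simp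
  then show ?case using assms(1) by (simp only: neighbour_mean_const)
qed

lemma visits_0: "visits n B 0 x = 0"
  by (simp add: visits_def)

lemma visits_Suc:
  assumes "finite B"
  shows "visits n B (Suc k) x = neighbour_mean n (\<lambda>z. of_bool (z \<in> B) + visits n B k z) x"
proof -
  have "of_bool (z \<in> B) + visits n B k z = (\<Sum>y\<in>B. \<Sum>j<Suc k. trans_prob n j z y)" for z
  proof -
    have "(\<Sum>y\<in>B. trans_prob n 0 z y) = of_bool (z \<in> B)"
      using assms by (simp add: of_bool_def)
    moreover have "(\<Sum>j<Suc k. trans_prob n j z y) = trans_prob n 0 z y + (\<Sum>j=1..k. trans_prob n j z y)" for y
      by (subst sum.lessThan_Suc_shift)
        (simp add: sum.atLeast1_atMost_eq del: trans_prob.simps)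
    ultimately show ?thesis by (simp add: visits_def sum.distrib del: trans_prob.simps sum.lessThan_Suc)
  qed
  then have "neighbour_mean n (\<lambda>z. of_bool (z \<in> B) + visits n B k z) x
      = (\<Sum>y\<in>B. \<Sum>j<Suc k. trans_prob n (Suc j) x y)"
    by (simp add: neighbour_mean_sum del: sum.lessThan_Suc)
  also have "\<dots> = visits n B (Suc k) x"
    by (simp only: visits_def One_nat_def sum.atLeast1_atMost_eq)
  finally show ?thesis ..
qed

lemma visits_nonneg: "visits n B k x \<ge> 0"
  unfolding visits_def by (intro sum_nonneg trans_prob_nonneg)

lemma visits_mono: "k \<le> l \<Longrightarrow> visits n B k x \<le> visits n B l x"
  unfolding visits_def by (intro sum_mono sum_mono2) (auto simp: trans_prob_nonneg)

lemma avoid_bounds: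
  assumes "n \<ge> 1"
  shows "0 \<le> avoid n B k x" "avoid n B k x \<le> 1"
proof -
  have "0 \<le> avoid n B k x \<and> avoid n B k x \<le> 1"
  proof (induction k arbitrary: x)
    case (Suc k)
    have "neighbour_mean n (\<lambda>_. 0) x \<le> avoid n B (Suc k) x"
      unfolding avoid.simps using Suc by (intro neighbour_mean_mono) simp
    moreover have "avoid n B (Suc k) x \<le> neighbour_mean n (\<lambda>_. 1) x"
      unfolding avoid.simps using Suc by (intro neighbour_mean_mono) simp
    ultimately show ?case using assms by (simp only: neighbour_mean_const)
  qed simp
  then show "0 \<le> avoid n B k x" "avoid n B k x \<le> 1" by auto
qed

lemma avoid_Suc_le: 
  assumes "n \<ge> 1" shows "avoid n B (Suc k) x \<le> avoid n B k x"
proof (induction k arbitrary: x)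
  case 0
  show ?case using avoid_bounds(2)[OF assms, of B "Suc 0" x] by simp
next
  case (Suc k)
  show ?case unfolding avoid.simps(2)[of n B "Suc k"] avoid.simps(2)[of n B k x]
    using Suc by (intro neighbour_mean_mono) simp
qed

lemma avoid_antimono: "n \<ge> 1 \<Longrightarrow> k \<le> l \<Longrightarrow> avoid n B l x \<le> avoid n B k x"
  by (rule lift_Suc_antimono_le[of "\<lambda>k. avoid n B k x"]) (rule avoid_Suc_le)

text \<open>Markov's inequality: the probability of a visit is at most the expected number of visits.\<close>

lemma avoid_ge:
  assumes "n \<ge> 1" "finite B"
  shows "1 - visits n B k x \<le> avoid n B k x"
proof (induction k arbitrary: x)
  case 0
  then show ?case by (simp add: visits_0)
next
  case (Suc k)
  have "1 - visits n B (Suc k) x = neighbour_mean n (\<lambda>z. 1 - (of_bool (z \<in> B) + visits n B k z)) x"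
    unfolding neighbour_mean_diff visits_Suc[OF assms(2)] neighbour_mean_const[OF assms(1)] ..
  also have "\<dots> \<le> avoid n B (Suc k) x"
    unfolding avoid.simps
    by (intro neighbour_mean_mono) (use Suc visits_nonneg in auto)
  finally show ?case .
qed

text \<open>Decompose at the first visit: a walk that has entered \<open>B\<close> at \<open>z\<close> makes \<open>1\<close> visit there and then
  at most \<open>visits n B T z\<close> further ones in expectation. This is the counterpart of Markov's
  inequality, useful when visits hardly cluster, that is, for \<open>C\<close> close to \<open>1\<close>.\<close>

lemma visits_le:
  assumes "n \<ge> 1" "finite B" and C: "\<And>z. z \<in> hypercube n \<Longrightarrow> 1 + visits n B T z \<le> C"
    and "k \<le> T" "x \<in> hypercube n"
  shows "visits n B k x \<le> C * (1 - avoid n B k x)"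
  using assms(4,5)
proof (induction k arbitrary: x)
  case 0
  then show ?case by (simp add: visits_0)
next
  case (Suc k)
  have "visits n B (Suc k) x \<le> neighbour_mean n (\<lambda>z. C * (1 - (if z \<in> B then 0 else avoid n B k z))) x"
    unfolding visits_Suc[OF assms(2)]
  proof (intro neighbour_mean_mono)
    fix i
    have "visits n B k (flip i x) \<le> visits n B T (flip i x)"
      using Suc.prems by (intro visits_mono) simp
    then show "of_bool (flip i x \<in> B) + visits n B k (flip i x)
        \<le> C * (1 - (if flip i x \<in> B then 0 else avoid n B k (flip i x)))"
      using Suc.IH[of "flip i x"] Suc.prems C[of "flip i x"] by auto
  qed
  also have "\<dots> = C * (1 - avoid n B (Suc k) x)"
    unfolding neighbour_mean_cmult neighbour_mean_diff neighbour_mean_const[OF assms(1)] avoid.simps ..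
  finally show ?case .
qed

lemma avoid_add_le:
  assumes "n \<ge> 1" and M: "\<And>z. z \<in> hypercube n \<Longrightarrow> avoid n B l z \<le> M" and "x \<in> hypercube n"
  shows "avoid n B (k + l) x \<le> avoid n B k x * M"
  using assms(3)
proof (induction k arbitrary: x)
  case 0
  then show ?case using M by simp
next
  case (Suc k)
  have "avoid n B (Suc k + l) x \<le> neighbour_mean n (\<lambda>z. M * (if z \<in> B then 0 else avoid n B k z)) x"
    unfolding add_Suc avoid.simps
    by (intro neighbour_mean_mono) (use Suc in \<open>auto simp: mult.commute\<close>)
  then show ?case by (simp add: neighbour_mean_cmult mult.commute)
qed

lemma avoid_add_ge:
  assumes "n \<ge> 1" and M: "\<And>z. z \<in> hypercube n \<Longrightarrow> M \<le> avoid n B l z" and "x \<in> hypercube n"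
  shows "avoid n B k x * M \<le> avoid n B (k + l) x"
  using assms(3)
proof (induction k arbitrary: x)
  case 0
  then show ?case using M by simp
next
  case (Suc k)
  have "neighbour_mean n (\<lambda>z. M * (if z \<in> B then 0 else avoid n B k z)) x \<le> avoid n B (Suc k + l) x"
    unfolding add_Suc avoid.simps
    by (intro neighbour_mean_mono) (use Suc in \<open>auto simp: mult.commute\<close>)
  then show ?case by (simp add: neighbour_mean_cmult mult.commute)
qed

lemma avoid_mult_le:
  assumes "n \<ge> 1" and M: "\<And>z. z \<in> hypercube n \<Longrightarrow> avoid n B T z \<le> M" and x: "x \<in> hypercube n"
  shows "avoid n B (K * T) x \<le> M ^ K"
proof (induction K)
  case (Suc K)
  have "0 \<le> M" using avoid_bounds(1)[OF assms(1)] M[OF x] by (rule order_trans)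
  have "avoid n B (Suc K * T) x = avoid n B (K * T + T) x" by (simp add: add.commute)
  also have "\<dots> \<le> avoid n B (K * T) x * M" by (rule avoid_add_le[OF assms])
  also have "\<dots> \<le> M ^ K * M" using Suc \<open>0 \<le> M\<close> by (rule mult_right_mono)
  finally show ?case by (simp add: mult.commute)
qed simp

lemma avoid_mult_ge:
  assumes "n \<ge> 1" and M: "\<And>z. z \<in> hypercube n \<Longrightarrow> M \<le> avoid n B T z" "0 \<le> M" and x: "x \<in> hypercube n"
  shows "M ^ K \<le> avoid n B (K * T) x"
proof (induction K)
  case (Suc K)
  have "M ^ Suc K = M ^ K * M" by simp
  also have "\<dots> \<le> avoid n B (K * T) x * M" using Suc M(2) by (rule mult_right_mono)
  also have "\<dots> \<le> avoid n B (K * T + T) x" by (rule avoid_add_ge[OF assms(1,2) x])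
  finally show ?case by (simp add: add.commute)
qed simp

text \<open>When the expected number of visits in a block of \<open>T\<close> steps is nearly the same number \<open>\<delta>\<close> from every
  starting point, \<open>avoid_ge\<close> and \<open>visits_le\<close> bound the probability of a visit in one block from both
  sides, uniformly in the position at which the block begins. By the Markov property the bounds then
  multiply over \<open>K\<close> consecutive blocks.\<close>

lemma avoid_block_bounds:
  assumes n: "n \<ge> 1" and B: "finite B" and x: "x \<in> hypercube n"
    and v: "\<And>z. z \<in> hypercube n \<Longrightarrow> \<bar>visits n B T z - \<delta>\<bar> \<le> \<epsilon>"
  shows "\<delta> + \<epsilon> \<le> 1 \<Longrightarrow> (1 - (\<delta> + \<epsilon>)) ^ K \<le> avoid n B (K * T) x"
    and "avoid n B (K * T) x \<le> (1 - (\<delta> - \<epsilon>) / (1 + \<delta> + \<epsilon>)) ^ K"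
proof -
  assume "\<delta> + \<epsilon> \<le> 1"
  then show "(1 - (\<delta> + \<epsilon>)) ^ K \<le> avoid n B (K * T) x"
  proof (intro avoid_mult_ge[OF n _ _ x])
    fix z assume "z \<in> hypercube n"
    then show "1 - (\<delta> + \<epsilon>) \<le> avoid n B T z"
      using avoid_ge[OF n B, of T z] v[of z] by linarith
  qed simp
next
  show "avoid n B (K * T) x \<le> (1 - (\<delta> - \<epsilon>) / (1 + \<delta> + \<epsilon>)) ^ K"
  proof (intro avoid_mult_le[OF n _ x])
    fix z assume z: "z \<in> hypercube n"
    have "1 + visits n B T y \<le> 1 + \<delta> + \<epsilon>" if "y \<in> hypercube n" for y using v[OF that] by linarith
    from visits_le[OF n B this order_refl z]
    have "\<delta> - \<epsilon> \<le> (1 + \<delta> + \<epsilon>) * (1 - avoid n B T z)" using v[OF z] by linarith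
    moreover have "0 < 1 + \<delta> + \<epsilon>" using v[OF z] visits_nonneg[of n B T z] by linarith
    ultimately have "(\<delta> - \<epsilon>) / (1 + \<delta> + \<epsilon>) \<le> 1 - avoid n B T z"
      by (simp add: divide_le_eq mult.commute)
    then show "avoid n B T z \<le> 1 - (\<delta> - \<epsilon>) / (1 + \<delta> + \<epsilon>)" by linarith
  qed
qed

section \<open>Spectral decomposition of the walk\<close>

text \<open>The Walsh function of \<open>S\<close>, centred at \<open>y\<close>. Flipping a coordinate changes its sign exactly when the
  coordinate lies in \<open>S\<close>, so it is an eigenfunction of \<open>neighbour_mean\<close>.\<close>

definition walsh :: "nat set \<Rightarrow> bool list \<Rightarrow> bool list \<Rightarrow> real" where
  "walsh S x y = (\<Prod>i\<in>S. if x ! i = y ! i then 1 else - 1)"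

definition eigenvalue :: "nat \<Rightarrow> nat set \<Rightarrow> real" where
  "eigenvalue n S = 1 - 2 * real (card S) / real n"

lemma sum_Pow_prod:
  fixes f :: "'a \<Rightarrow> real"
  assumes "finite A"
  shows "(\<Sum>S\<in>Pow A. \<Prod>i\<in>S. f i) = (\<Prod>i\<in>A. 1 + f i)"
  using prod_add[OF assms, of f "\<lambda>_. 1"] by (simp add: add.commute)

lemma sum_Pow_power_card: "(\<Sum>S\<in>Pow {..<n}. r ^ card S) = (1 + r :: real) ^ n"
  using sum_Pow_prod[of "{..<n}" "\<lambda>_. r"] by simp

lemma abs_walsh: "\<bar>walsh S x y\<bar> = 1"
  unfolding walsh_def abs_prod by (rule prod.neutral) auto

lemma card_subset_lessThan: "S \<subseteq> {..<n} \<Longrightarrow> card S \<le> n"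
  using card_mono[of "{..<n}" S] by simp

lemma abs_eigenvalue_le_1: "S \<subseteq> {..<n} \<Longrightarrow> \<bar>eigenvalue n S\<bar> \<le> 1"
  using card_subset_lessThan[of S n]
  by (cases "n = 0") (auto simp: eigenvalue_def abs_le_iff field_simps)

lemma walsh_flip:
  assumes "x \<in> hypercube n" "i < n" "S \<subseteq> {..<n}"
  shows "walsh S (flip i x) y = (if i \<in> S then - walsh S x y else walsh S x y)"
proof -
  have fin: "finite S" using assms(3) by (rule finite_subset) simp
  have same: "walsh R (flip i x) y = walsh R x y" if "R \<subseteq> S" "i \<notin> R" for R
    unfolding walsh_def
  proof (rule prod.cong[OF refl])
    fix j assume "j \<in> R"
    then have "j < n" "j \<noteq> i" using that assms(3) by auto
    then have "flip i x ! j = x ! j" using assms(1,2) by (simp add: flip_nth)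
    then show "(if flip i x ! j = y ! j then 1 else - 1 :: real) = (if x ! j = y ! j then 1 else - 1)"
      by simp
  qed
  show ?thesis
  proof (cases "i \<in> S")
    case True
    \<comment> \<open>Split off the factor of the flipped coordinate.\<close>
    have remove: "walsh S z y = (if z ! i = y ! i then 1 else - 1) * walsh (S - {i}) z y" for z
      unfolding walsh_def by (rule prod.remove[OF fin True])
    have sign: "(if flip i x ! i = y ! i then 1 else - 1 :: real) = - (if x ! i = y ! i then 1 else - 1)"
      unfolding flip_nth[OF assms(1,2,2)] by simp
    have "walsh S (flip i x) y = - walsh S x y"
      unfolding remove[of "flip i x"] remove[of x] sign same[OF Diff_subset, of "{i}", simplified] by simp
    with True show ?thesis by simp
  next
    case False
    then show ?thesis using same[OF order_refl] by simp
  qed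
qed

lemma neighbour_mean_walsh:
  assumes "n \<ge> 1" "x \<in> hypercube n" "S \<subseteq> {..<n}"
  shows "neighbour_mean n (\<lambda>z. walsh S z y) x = eigenvalue n S * walsh S x y"
proof -
  have S: "{..<n} \<inter> S = S" using assms(3) by auto
  have "(\<Sum>i<n. walsh S (flip i x) y) = (\<Sum>i<n. (1 - 2 * of_bool (i \<in> S)) * walsh S x y)"
    by (rule sum.cong) (simp_all add: walsh_flip[OF assms(2) _ assms(3)])
  also have "\<dots> = (\<Sum>i<n. 1 - 2 * of_bool (i \<in> S)) * walsh S x y"
    by (rule sum_distrib_right[symmetric])
  also have "(\<Sum>i<n. 1 - 2 * of_bool (i \<in> S)) = real n - (\<Sum>i<n. 2 * of_bool (i \<in> S))"
    by (simp add: sum_subtractf)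
  also have "(\<Sum>i<n. 2 * of_bool (i \<in> S)) = 2 * (\<Sum>i<n. of_bool (i \<in> S) :: real)"
    by (rule sum_distrib_left[symmetric])
  also have "(\<Sum>i<n. of_bool (i \<in> S) :: real) = real (card S)"
    by (simp add: S)
  finally show ?thesis using assms(1)
    by (simp add: neighbour_mean_def eigenvalue_def diff_divide_distrib flip: times_divide_eq_left)
qed

text \<open>The point mass at \<open>y\<close> is the average of all Walsh functions, and each step multiplies every Walsh
  function by its eigenvalue.\<close>

lemma trans_prob_spectral:
  assumes "n \<ge> 1" "x \<in> hypercube n" "y \<in> hypercube n"
  shows "trans_prob n k x y = (\<Sum>S\<in>Pow {..<n}. walsh S x y * eigenvalue n S ^ k) / 2 ^ n"
  using assms(2)
proof (induction k arbitrary: x)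
  case 0
  have "(\<Sum>S\<in>Pow {..<n}. walsh S x y) = (\<Prod>i<n. 1 + (if x ! i = y ! i then 1 else - 1))"
    unfolding walsh_def by (rule sum_Pow_prod) simp
  also have "\<dots> = 2 ^ n * of_bool (x = y)"
  proof (cases "x = y")
    case False
    then obtain i where "i < n" "x ! i \<noteq> y ! i" using hypercube_eqI[OF 0 assms(3)] by blast
    then show ?thesis using False by (auto intro!: prod_zero)
  qed simp
  finally show ?case by simp
next
  case (Suc k)
  have "trans_prob n (Suc k) x y
      = neighbour_mean n (\<lambda>z. \<Sum>S\<in>Pow {..<n}. (eigenvalue n S ^ k / 2 ^ n) * walsh S z y) x"
    unfolding trans_prob.simps using Suc
    by (intro neighbour_mean_cong) (simp add: sum_divide_distrib mult.commute)
  also have "\<dots> = (\<Sum>S\<in>Pow {..<n}. (eigenvalue n S ^ k / 2 ^ n) * (eigenvalue n S * walsh S x y))"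
    unfolding neighbour_mean_sum neighbour_mean_cmult
    using Suc.prems assms by (intro sum.cong) (auto simp: neighbour_mean_walsh)
  also have "\<dots> = (\<Sum>S\<in>Pow {..<n}. walsh S x y * eigenvalue n S ^ Suc k) / 2 ^ n"
    unfolding sum_divide_distrib by (intro sum.cong) (auto simp: field_simps)
  finally show ?case .
qed

section \<open>Mixing\<close>

lemma sum_Pow_compl: "(\<Sum>S\<in>Pow {..<n}. f (n - card S)) = (\<Sum>S\<in>Pow {..<n}. f (card S))"
  by (rule sum.reindex_bij_witness[where i = "\<lambda>S. {..<n} - S" and j = "\<lambda>S. {..<n} - S"])
    (auto simp: card_Diff_subset finite_subset[of _ "{..<n}"] double_diff)

text \<open>The modulus of the eigenvalue is \<open>1 - 2j/n \<le> exp (- 2j/n)\<close>, where \<open>j\<close> is the smaller of \<open>card S\<close>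
  and \<open>n - card S\<close>.\<close>

lemma abs_eigenvalue_power_le:
  fixes k :: nat
  assumes "n \<ge> 1" "S \<subseteq> {..<n}"
  defines "r \<equiv> exp (- 2 * real k / real n)"
  shows "\<bar>eigenvalue n S\<bar> ^ k \<le> r ^ card S + r ^ (n - card S)"
proof -
  have le: "\<bar>1 - 2 * real j / real n\<bar> ^ k \<le> r ^ j" if "1 - 2 * real j / real n \<ge> 0" for j
  proof -
    have "\<bar>1 - 2 * real j / real n\<bar> ^ k \<le> exp (- 2 * real j / real n) ^ k"
      using that exp_ge_add_one_self[of "- 2 * real j / real n"] by (intro power_mono) auto
    also have "\<dots> = r ^ j" by (simp add: r_def mult_ac flip: exp_of_nat_mult)
    finally show ?thesis .
  qed
  have card: "real (n - card S) = real n - real (card S)"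
    using card_subset_lessThan[OF assms(2)] by simp
  have "r > 0" by (simp add: r_def)
  show ?thesis
  proof (cases "eigenvalue n S \<ge> 0")
    case True
    then show ?thesis using le[of "card S"] \<open>r > 0\<close> by (simp add: eigenvalue_def add_increasing2)
  next
    case False
    have eq: "1 - 2 * real (n - card S) / real n = - eigenvalue n S"
      using assms(1) by (simp add: card eigenvalue_def field_simps)
    then show ?thesis using le[of "n - card S"] \<open>r > 0\<close> False by (simp add: add_increasing)
  qed
qed

text \<open>The walk changes parity at each step, so a single transition probability does not converge. In the
  sum over two consecutive times the eigenvalue \<open>-1\<close> of the full set cancels, the eigenvalue \<open>1\<close> of
  the empty set contributes the uniform distribution, and the remaining ones add up to at most
  \<open>4 ((1 + r)\<^sup>n - 1) / 2\<^sup>n\<close> with \<open>r = exp (- 2k/n)\<close>. This is small compared with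
  \<open>1 / 2\<^sup>n\<close> once \<open>n r\<close> is small, which is the case from time \<open>n ln n\<close> on.\<close>

lemma trans_prob_pair:
  assumes n: "n \<ge> 1" and x: "x \<in> hypercube n" and y: "y \<in> hypercube n"
    and k: "real n * ln (real n) \<le> real k"
  shows "\<bar>trans_prob n k x y + trans_prob n (Suc k) x y - 2 / 2 ^ n\<bar> \<le> (8 / n) / 2 ^ n"
proof -
  define r where "r = exp (- 2 * real k / real n)"
  define f where "f S = walsh S x y * eigenvalue n S ^ k * (1 + eigenvalue n S)" for S
  define R where "R = Pow {..<n} - {{}, {..<n}}"
  have r: "0 \<le> r" "r \<le> 1 / real n ^ 2"
  proof -
    have "ln (real n) \<le> real k / real n" using k n by (simp add: pos_le_divide_eq mult.commute)
    then have "r \<le> exp (- (ln (real n) * 2))" unfolding r_def by (subst exp_le_cancel_iff) simp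
    also have "\<dots> = 1 / real n ^ 2"
      using n by (simp add: exp_minus inverse_eq_divide exp_double mult.commute[of _ 2])
    finally show "r \<le> 1 / real n ^ 2" .
  qed (simp add: r_def)
  have "0 \<in> {..<n}" using n by simp
  then have ne: "{} \<noteq> {..<n}" by blast
  have "trans_prob n k x y + trans_prob n (Suc k) x y = (\<Sum>S\<in>Pow {..<n}. f S) / 2 ^ n"
    unfolding trans_prob_spectral[OF n x y] add_divide_distrib[symmetric] sum.distrib[symmetric] f_def
    by (simp add: algebra_simps)
  also have "(\<Sum>S\<in>Pow {..<n}. f S) = f {} + (f {..<n} + sum f R)"
    unfolding R_def using ne
    by (subst sum.remove[of _ "{}"], simp, simp, subst sum.remove[of _ "{..<n}"])
      (auto intro!: arg_cong[where f = "sum f"])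
  also have "f {} = 2" by (simp add: f_def walsh_def eigenvalue_def)
  also have "f {..<n} = 0" using n by (simp add: f_def eigenvalue_def)
  finally have eq: "trans_prob n k x y + trans_prob n (Suc k) x y - 2 / 2 ^ n = sum f R / 2 ^ n"
    by (simp add: add_divide_distrib)
  have "\<bar>sum f R\<bar> \<le> (\<Sum>S\<in>R. 2 * (r ^ card S + r ^ (n - card S)))"
  proof (rule order_trans[OF sum_abs sum_mono])
    fix S assume "S \<in> R"
    then have S: "S \<subseteq> {..<n}" by (auto simp: R_def)
    have "\<bar>f S\<bar> = \<bar>eigenvalue n S\<bar> ^ k * \<bar>1 + eigenvalue n S\<bar>"
      by (simp add: f_def abs_mult abs_walsh power_abs)
    also have "\<dots> \<le> (r ^ card S + r ^ (n - card S)) * 2"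
      unfolding r_def using abs_eigenvalue_le_1[OF S]
      by (intro mult_mono abs_eigenvalue_power_le n S) auto
    finally show "\<bar>f S\<bar> \<le> 2 * (r ^ card S + r ^ (n - card S))" by simp
  qed
  also have "\<dots> = 2 * (\<Sum>S\<in>R. r ^ card S) + 2 * (\<Sum>S\<in>R. r ^ (n - card S))"
    by (simp add: sum.distrib sum_distrib_left[symmetric])
  finally have sum_le: "\<bar>sum f R\<bar> \<le> 2 * (\<Sum>S\<in>R. r ^ card S) + 2 * (\<Sum>S\<in>R. r ^ (n - card S))" .
  have "(\<Sum>S\<in>R. r ^ card S) \<le> (\<Sum>S\<in>Pow {..<n} - {{}}. r ^ card S)"
    unfolding R_def using r(1) by (intro sum_mono2) auto
  also have "\<dots> = (1 + r) ^ n - 1"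
    by (subst sum_diff1) (auto simp: sum_Pow_power_card)
  finally have 1: "(\<Sum>S\<in>R. r ^ card S) \<le> (1 + r) ^ n - 1" .
  have "(\<Sum>S\<in>R. r ^ (n - card S)) \<le> (\<Sum>S\<in>Pow {..<n} - {{..<n}}. r ^ (n - card S))"
    unfolding R_def using r(1) by (intro sum_mono2) auto
  also have "\<dots> = (1 + r) ^ n - 1"
    by (subst sum_diff1) (auto simp: sum_Pow_power_card sum_Pow_compl[of "\<lambda>j. r ^ j"])
  finally have 2: "(\<Sum>S\<in>R. r ^ (n - card S)) \<le> (1 + r) ^ n - 1" .
  have "(1 + r) ^ n \<le> exp r ^ n"
    using r(1) by (intro power_mono) auto
  also have "\<dots> = exp (real n * r)" by (simp add: exp_of_nat_mult)
  also have "\<dots> \<le> exp (1 / n)"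
    using mult_left_mono[OF r(2), of "real n"] n by (simp add: power2_eq_square)
  also have "\<dots> \<le> 1 + 1 / n + (1 / n) ^ 2"
    using n by (intro exp_bound) auto
  also have "\<dots> \<le> 1 + 1 / n + 1 / n"
  proof -
    have "(1 / n) ^ 2 \<le> 1 / real n * 1"
      unfolding power2_eq_square using n by (intro mult_left_mono) auto
    then show ?thesis by simp
  qed
  finally have 3: "(1 + r) ^ n - 1 \<le> 2 / n" by simp
  have "\<bar>sum f R\<bar> \<le> 8 / n" using sum_le 1 2 3 by simp
  then have "\<bar>sum f R\<bar> / 2 ^ n \<le> 8 / n / 2 ^ n" by (rule divide_right_mono) simp
  then show ?thesis unfolding eq by simp
qed

section \<open>Transition probabilities before mixing\<close>

lemma exp_le_quadratic:
  assumes "\<bar>t\<bar> \<le> (1::real)"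
  shows "exp t \<le> 1 + t + t ^ 2"
proof (cases "t \<ge> 0")
  case True
  then show ?thesis using exp_bound[of t] assms by simp
next
  case False
  have "0 \<le> (- t) * t ^ 2"
    using False by (intro mult_nonneg_nonneg) auto
  then have "1 \<le> (1 - t) * (1 + t + t ^ 2)"
    by (simp add: algebra_simps power2_eq_square)
  also have "\<dots> \<le> exp (- t) * (1 + t + t ^ 2)"
  proof (rule mult_right_mono)
    show "1 - t \<le> exp (- t)" using exp_ge_add_one_self[of "- t"] by simp
    show "0 \<le> 1 + t + t ^ 2" using assms by (simp add: abs_le_iff add_nonneg_nonneg)
  qed
  finally have "1 \<le> exp (- t) * (1 + t + t ^ 2)" .
  then show ?thesis by (simp add: exp_minus field_simps)
qed

lemma power6_le_exp: "(u::real) ^ 6 \<le> 720 * (exp u + exp (- u))"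
proof -
  have *: "v ^ 6 \<le> 720 * exp v" if "v \<ge> 0" for v :: real
  proof -
    have "v ^ 6 /\<^sub>R fact 6 \<le> exp v"
      unfolding exp_def using that
      by (intro sum_le_suminf[OF summable_exp_generic, of "{6}", simplified]) auto
    moreover have "fact 6 = (720::real)" by (simp add: fact_numeral)
    ultimately show ?thesis by (simp add: field_simps)
  qed
  show ?thesis
  proof (cases "u \<ge> 0")
    case True
    have "720 * exp u \<le> 720 * (exp u + exp (- u))" by simp
    with *[OF True] show ?thesis by linarith
  next
    case False
    have "u ^ 6 \<le> 720 * exp (- u)" using *[of "- u"] False by simp
    then show ?thesis using exp_gt_zero[of u] unfolding distrib_left by linarith
  qed
qed

text \<open>For a uniformly chosen \<open>S\<close> the eigenvalue is the mean of \<open>n\<close> independent signs, so it is of order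
  \<open>n powr (- 1/2)\<close>; the sixth moment is estimated through the moment generating function at the scale
  \<open>sqrt n\<close>.\<close>

lemma sum_eigenvalue_power6:
  assumes n: "n \<ge> 1"
  shows "(\<Sum>S\<in>Pow {..<n}. eigenvalue n S ^ 6) \<le> (4320 / real n ^ 3) * 2 ^ n"
proof -
  define c where "c = sqrt (real n)"
  have c: "c > 0" "c ^ 2 = real n" "c \<ge> 1" using n by (auto simp: c_def)
  have mgf: "(\<Sum>S\<in>Pow {..<n}. exp (\<sigma> * (c * eigenvalue n S))) \<le> 2 ^ n * exp 1" if \<sigma>: "\<bar>\<sigma>\<bar> = 1" for \<sigma>
  proof -
    define t where "t = \<sigma> / c"
    have t: "\<bar>t\<bar> \<le> 1" "t ^ 2 = 1 / n"
      using c \<sigma> by (auto simp: t_def power_divide abs_square_eq_1 divide_le_eq)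
    have "exp (\<sigma> * (c * eigenvalue n S)) = exp t ^ n * exp (- 2 * t) ^ card S" for S
    proof -
      have cn: "c / real n = 1 / c" using c(1) c(2)[symmetric] by (simp add: power2_eq_square)
      have "\<sigma> * (c * eigenvalue n S) = \<sigma> * (c / n * (real n - 2 * real (card S)))"
        using n by (simp add: eigenvalue_def field_simps)
      also have "\<dots> = real n * t + real (card S) * (- 2 * t)"
        unfolding cn t_def by (simp add: diff_divide_distrib right_diff_distrib mult_ac)
      finally show ?thesis by (simp only: exp_add exp_of_nat_mult)
    qed
    then have "(\<Sum>S\<in>Pow {..<n}. exp (\<sigma> * (c * eigenvalue n S))) = exp t ^ n * (1 + exp (- 2 * t)) ^ n"
      by (simp add: sum_distrib_left[symmetric] sum_Pow_power_card)
    also have "\<dots> = (exp t + exp (- t)) ^ n"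
      by (simp add: power_mult_distrib[symmetric] algebra_simps exp_add[symmetric])
    also have "\<dots> \<le> (2 * exp (t ^ 2)) ^ n"
    proof (rule power_mono)
      have "exp t + exp (- t) \<le> 2 * (1 + t ^ 2)"
        using exp_le_quadratic[of t] exp_le_quadratic[of "- t"] t(1) by simp
      also have "\<dots> \<le> 2 * exp (t ^ 2)" by (rule mult_left_mono[OF exp_ge_add_one_self]) simp
      finally show "exp t + exp (- t) \<le> 2 * exp (t ^ 2)" .
    qed (simp add: add_nonneg_nonneg)
    also have "\<dots> = 2 ^ n * exp (real n * t ^ 2)"
      by (simp only: power_mult_distrib exp_of_nat_mult)
    also have "real n * t ^ 2 = 1" using n by (simp add: t(2))
    finally show ?thesis .
  qed
  have "c ^ 6 * (\<Sum>S\<in>Pow {..<n}. eigenvalue n S ^ 6) = (\<Sum>S\<in>Pow {..<n}. (c * eigenvalue n S) ^ 6)"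
    by (simp add: sum_distrib_left power_mult_distrib)
  also have "\<dots> \<le> (\<Sum>S\<in>Pow {..<n}. 720 * (exp (c * eigenvalue n S) + exp (- (c * eigenvalue n S))))"
    by (intro sum_mono power6_le_exp)
  also have "\<dots> = 720 * ((\<Sum>S\<in>Pow {..<n}. exp (c * eigenvalue n S))
      + (\<Sum>S\<in>Pow {..<n}. exp (- (c * eigenvalue n S))))"
    by (simp add: sum_distrib_left[symmetric] sum.distrib)
  also have "\<dots> \<le> 720 * (2 ^ n * exp 1 + 2 ^ n * exp 1)"
    by (intro mult_left_mono add_mono) (use mgf[of 1] mgf[of "- 1"] in simp_all)
  also have "\<dots> \<le> 4320 * 2 ^ n"
    using exp_le by simp
  finally have "c ^ 6 * (\<Sum>S\<in>Pow {..<n}. eigenvalue n S ^ 6) \<le> 4320 * 2 ^ n" .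
  moreover have "c ^ 6 = real n ^ 3" unfolding c(2)[symmetric] by (simp flip: power_mult)
  ultimately show ?thesis using n by (simp add: field_simps)
qed

text \<open>All eigenvalues have modulus at most \<open>1\<close>, so from the sixth step on the transition probabilities are
  bounded by the sixth moment of the spectrum.\<close>

lemma trans_prob_le_cube:
  assumes "n \<ge> 1" "x \<in> hypercube n" "y \<in> hypercube n" "k \<ge> 6"
  shows "trans_prob n k x y \<le> 4320 / real n ^ 3"
proof -
  have "(\<Sum>S\<in>Pow {..<n}. walsh S x y * eigenvalue n S ^ k) \<le> (\<Sum>S\<in>Pow {..<n}. eigenvalue n S ^ 6)"
  proof (rule sum_mono)
    fix S assume "S \<in> Pow {..<n}"
    then have S: "\<bar>eigenvalue n S\<bar> \<le> 1" by (intro abs_eigenvalue_le_1) auto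
    have "walsh S x y * eigenvalue n S ^ k \<le> \<bar>walsh S x y * eigenvalue n S ^ k\<bar>" by (rule abs_ge_self)
    also have "\<dots> = \<bar>eigenvalue n S\<bar> ^ k" by (simp add: abs_mult abs_walsh power_abs)
    also have "\<dots> \<le> \<bar>eigenvalue n S\<bar> ^ 6" using S assms(4) by (intro power_decreasing) auto
    also have "\<dots> = eigenvalue n S ^ 6" by (rule power_even_abs) simp
    finally show "walsh S x y * eigenvalue n S ^ k \<le> eigenvalue n S ^ 6" .
  qed
  also have "\<dots> \<le> (4320 / real n ^ 3) * 2 ^ n" by (rule sum_eigenvalue_power6[OF assms(1)])
  finally show ?thesis
    unfolding trans_prob_spectral[OF assms(1-3)] by (simp add: divide_le_eq)
qed

text \<open>The first five steps contribute at most \<open>1/n\<close> each; the later ones are so unlikely to end in \<open>y\<close>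
  that even \<open>n\<^sup>2\<close> of them contribute only another multiple of \<open>1/n\<close>. A bound of order \<open>1/n\<close>
  matters: exponential moments with parameter proportional to \<open>n\<close> are taken of it in
  \<open>prob_many_visits\<close>.\<close>

lemma sum_trans_prob_short:
  assumes n: "n \<ge> 1" and x: "x \<in> hypercube n" and y: "y \<in> hypercube n" and s: "s \<le> n ^ 2"
  shows "(\<Sum>j=1..s. trans_prob n j x y) \<le> 4325 / n"
proof -
  have le: "trans_prob n j x y \<le> (if j \<le> 5 then 1 / n else 0) + 4320 / real n ^ 3" if "j \<in> {1..s}" for j
  proof (cases "j \<le> 5")
    case True
    obtain i where "j = Suc i" using \<open>j \<in> {1..s}\<close> by (cases j) auto
    then have "trans_prob n j x y \<le> 1 / n" using trans_prob_Suc_le[OF n x] by simp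
    then show ?thesis using True by (simp add: add_increasing2)
  qed (use trans_prob_le_cube[OF n x y] in auto)
  have "(\<Sum>j=1..s. trans_prob n j x y) \<le> (\<Sum>j=1..s. (if j \<le> 5 then 1 / n else 0) + 4320 / real n ^ 3)"
    by (intro sum_mono le)
  also have "\<dots> = real (card ({1..s} \<inter> {j. j \<le> 5})) * (1 / n) + real s * (4320 / real n ^ 3)"
    by (simp add: sum.distrib sum.If_cases)
  also have "\<dots> \<le> 5 * (1 / n) + real n ^ 2 * (4320 / real n ^ 3)"
  proof (intro add_mono mult_right_mono)
    have "card ({1..s} \<inter> {j. j \<le> 5}) \<le> card {1..5::nat}" by (intro card_mono) auto
    then show "real (card ({1..s} \<inter> {j. j \<le> 5})) \<le> 5" by simp
    show "real s \<le> real n ^ 2" using s by (simp flip: of_nat_power)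
  qed simp_all
  also have "\<dots> = 4325 / n" using n by (simp add: field_simps power2_eq_square power3_eq_cube)
  finally show ?thesis .
qed

section \<open>Visits to a set are governed by its size\<close>

text \<open>Sums of consecutive pairs control the whole sum up to one term at either end, whatever the parity
  of its length.\<close>

lemma sum_bounds_of_pairs:
  fixes q :: "nat \<Rightarrow> real"
  assumes "\<And>k. 0 \<le> q k" "\<And>k. a \<le> q k + q (Suc k)" "\<And>k. q k + q (Suc k) \<le> b" "0 \<le> a"
  shows "(real l - 1) * (a / 2) \<le> sum q {..<l} \<and> sum q {..<l} \<le> (real l + 1) * (b / 2)"
proof (induction l rule: induct_nat_012)
  case 0
  then show ?case using assms(4) assms(1)[of 0] assms(1)[of 1] assms(3)[of 0] by simp
next
  case 1
  then show ?case using assms(1)[of 0] assms(1)[of 1] assms(3)[of 0] by simp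
next
  case (ge2 l)
  then show ?case using assms(2)[of l] assms(3)[of l] by (simp add: algebra_simps)
qed

text \<open>After time \<open>s\<close> the walk is mixed and spends the fraction \<open>\<beta>\<close> of its time in \<open>B\<close>, whatever the shape of
  \<open>B\<close>. Only the visits before \<open>s\<close> depend on the geometry.\<close>

lemma visits_bounds:
  assumes n: "n \<ge> 4" and x: "x \<in> hypercube n" and B: "B \<subseteq> hypercube n"
    and s: "real n * ln (real n) \<le> real s" and T: "s \<le> T"
  defines "\<beta> \<equiv> real (card B) / 2 ^ n"
  shows "visits n B T x \<le> visits n B s x + (real T + 1) * (\<beta> * (1 + 4 / n))"
    and "(real T - real s - 1) * (\<beta> * (1 - 4 / n)) \<le> visits n B T x"
proof -
  define q where "q k = (\<Sum>y\<in>B. trans_prob n (Suc (s + k)) x y)" for k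
  have n1: "n \<ge> 1" using n by simp
  have split: "visits n B T x = visits n B s x + sum q {..<T - s}"
  proof -
    have "(\<Sum>j=1..T. trans_prob n j x y)
        = (\<Sum>j=1..s. trans_prob n j x y) + (\<Sum>k<T - s. trans_prob n (Suc (s + k)) x y)" for y
    proof -
      have "{..<T} = {..<s} \<union> {s..<T}" using T by auto
      then have "(\<Sum>j<T. trans_prob n (Suc j) x y)
          = (\<Sum>j<s. trans_prob n (Suc j) x y) + (\<Sum>j=s..<T. trans_prob n (Suc j) x y)"
        by (simp only: sum.union_disjoint ivl_disj_int finite_lessThan finite_atLeastLessThan)
      also have "(\<Sum>j=s..<T. trans_prob n (Suc j) x y) = (\<Sum>k<T - s. trans_prob n (Suc (s + k)) x y)"
        using T by (intro sum.reindex_bij_witness[of _ "\<lambda>k. s + k" "\<lambda>j. j - s"]) auto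
      finally show ?thesis by (simp only: One_nat_def sum.atLeast1_atMost_eq)
    qed
    then show ?thesis
      unfolding visits_def q_def by (subst (2) sum.swap) (simp only: sum.distrib)
  qed
  have pair: "\<bar>q k + q (Suc k) - 2 * \<beta>\<bar> \<le> 8 / n * \<beta>" for k
  proof -
    have "q k + q (Suc k) - 2 * \<beta> = (\<Sum>y\<in>B. trans_prob n (Suc (s + k)) x y
        + trans_prob n (Suc (Suc (s + k))) x y - 2 / 2 ^ n)"
      unfolding q_def \<beta>_def by (simp add: sum_subtractf sum.distrib del: trans_prob.simps)
    also have "\<bar>\<dots>\<bar> \<le> (\<Sum>y\<in>B. 8 / n / 2 ^ n)"
      using s B by (intro order_trans[OF sum_abs] sum_mono trans_prob_pair n1 x) auto
    also have "\<dots> = 8 / n * \<beta>" unfolding \<beta>_def by simp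
    finally show ?thesis .
  qed
  have q: "q k \<ge> 0" for k unfolding q_def by (intro sum_nonneg trans_prob_nonneg)
  have \<beta>: "\<beta> \<ge> 0" by (simp add: \<beta>_def)
  have "(real (T - s) - 1) * (2 * (\<beta> * (1 - 4 / n)) / 2) \<le> sum q {..<T - s}
      \<and> sum q {..<T - s} \<le> (real (T - s) + 1) * (2 * (\<beta> * (1 + 4 / n)) / 2)"
  proof (rule sum_bounds_of_pairs[OF q])
    fix k
    show "2 * (\<beta> * (1 - 4 / n)) \<le> q k + q (Suc k)" "q k + q (Suc k) \<le> 2 * (\<beta> * (1 + 4 / n))"
      using pair[of k] by (simp_all add: abs_le_iff algebra_simps)
    show "0 \<le> 2 * (\<beta> * (1 - 4 / n))" using \<beta> n by (simp add: mult_nonneg_nonneg)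
  qed
  then have "(real (T - s) - 1) * (\<beta> * (1 - 4 / n)) \<le> sum q {..<T - s}"
    "sum q {..<T - s} \<le> (real (T - s) + 1) * (\<beta> * (1 + 4 / n))" by simp_all
  moreover have "(real (T - s) + 1) * (\<beta> * (1 + 4 / n)) \<le> (real T + 1) * (\<beta> * (1 + 4 / n))"
    using \<beta> by (intro mult_right_mono) (auto intro!: mult_nonneg_nonneg add_nonneg_nonneg)
  ultimately show "visits n B T x \<le> visits n B s x + (real T + 1) * (\<beta> * (1 + 4 / n))"
    and "(real T - real s - 1) * (\<beta> * (1 - 4 / n)) \<le> visits n B T x"
    using split visits_nonneg[of n B s x] T by (auto simp: of_nat_diff)
qed

section \<open>From the random walk to avoidance probabilities\<close>

context simple_random_walk
begin

lemma pred_position [measurable]: "Measurable.pred M (\<lambda>\<omega>. R (Y k \<omega>))"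
  by (rule measurable_compose[OF position_measurable]) simp

lemma prob_path_step:
  assumes y: "y \<in> hypercube n"
  shows "\<P>(\<omega> in M. \<forall>i\<le>Suc k. Y i \<omega> = (z(Suc k := y)) i) =
    \<P>(\<omega> in M. \<forall>i\<le>k. Y i \<omega> = z i) * (if hamming_dist n (z k) y = 1 then 1 / real n else 0)"
proof -
  have eq: "\<P>(\<omega> in M. \<forall>i\<le>Suc k. Y i \<omega> = (z(Suc k := y)) i)
      = \<P>(\<omega> in M. Y (Suc k) \<omega> = y \<and> (\<forall>i\<le>k. Y i \<omega> = z i))"
    by (rule arg_cong[where f = prob]) (auto simp: le_Suc_eq)
  show ?thesis
  proof (cases "\<P>(\<omega> in M. \<forall>i\<le>k. Y i \<omega> = z i) > 0")
    case True
    from transition[OF True y] show ?thesis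
      unfolding eq cond_prob_def using True by (simp add: divide_eq_eq mult.commute split: if_splits)
  next
    case False
    then have zero: "\<P>(\<omega> in M. \<forall>i\<le>k. Y i \<omega> = z i) = 0"
      using measure_nonneg[of M] by (meson antisym not_less)
    have "\<P>(\<omega> in M. Y (Suc k) \<omega> = y \<and> (\<forall>i\<le>k. Y i \<omega> = z i)) \<le> \<P>(\<omega> in M. \<forall>i\<le>k. Y i \<omega> = z i)"
      by (rule finite_measure_mono) auto
    then show ?thesis unfolding eq zero using measure_nonneg[of M] by (simp add: antisym)
  qed
qed

text \<open>Conditioning on the whole past turns the Markov property into an induction on the number \<open>l\<close> of
  future steps: the event is split according to the position \<open>y\<close> at time \<open>k + 1\<close>, and the path \<open>z\<close>
  is prolonged by \<open>y\<close>.\<close>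

lemma prob_path_avoid:
  "\<P>(\<omega> in M. (\<forall>i\<le>k. Y i \<omega> = z i) \<and> (\<forall>j. k < j \<and> j \<le> k + l \<longrightarrow> Y j \<omega> \<notin> B))
    = \<P>(\<omega> in M. \<forall>i\<le>k. Y i \<omega> = z i) * avoid n B l (z k)"
proof (induction l arbitrary: k z)
  case 0
  have "\<P>(\<omega> in M. (\<forall>i\<le>k. Y i \<omega> = z i) \<and> (\<forall>j. k < j \<and> j \<le> k + 0 \<longrightarrow> Y j \<omega> \<notin> B))
      = \<P>(\<omega> in M. \<forall>i\<le>k. Y i \<omega> = z i)"
    by (rule arg_cong[where f = prob]) auto
  then show ?case by simp
next
  case (Suc l)
  define p where "p = \<P>(\<omega> in M. \<forall>i\<le>k. Y i \<omega> = z i)"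
  define E where "E = {\<omega> \<in> space M. (\<forall>i\<le>k. Y i \<omega> = z i) \<and> (\<forall>j. k < j \<and> j \<le> k + Suc l \<longrightarrow> Y j \<omega> \<notin> B)}"
  define F where "F y = {\<omega> \<in> space M. (\<forall>i\<le>Suc k. Y i \<omega> = (z(Suc k := y)) i)
      \<and> (\<forall>j. Suc k < j \<and> j \<le> Suc k + l \<longrightarrow> Y j \<omega> \<notin> B)}" for y
  show ?case
  proof (cases "p = 0")
    case True
    have "prob E \<le> p" unfolding p_def E_def by (rule finite_measure_mono) auto
    then have "prob E = 0" using True measure_nonneg[of M E] by simp
    then show ?thesis using True by (simp add: E_def p_def)
  next
    case False
    have "{\<omega> \<in> space M. \<forall>i\<le>k. Y i \<omega> = z i} \<noteq> {}"
      using False unfolding p_def by (metis measure_empty)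
    then obtain \<omega> where "\<omega> \<in> space M" "Y k \<omega> = z k" by auto
    then have zk: "z k \<in> hypercube n"
      using measurable_space[OF position_measurable, of \<omega> k] by simp
    have "E = (\<Union>y\<in>hypercube n - B. F y)"
    proof (intro equalityI subsetI)
      fix \<omega> assume \<omega>: "\<omega> \<in> E"
      then have "Y (Suc k) \<omega> \<in> hypercube n - B"
        using measurable_space[OF position_measurable, of \<omega> "Suc k"] by (auto simp: E_def)
      moreover have "\<omega> \<in> F (Y (Suc k) \<omega>)" using \<omega> by (auto simp: E_def F_def le_Suc_eq)
      ultimately show "\<omega> \<in> (\<Union>y\<in>hypercube n - B. F y)" by blast
    next
      fix \<omega> assume "\<omega> \<in> (\<Union>y\<in>hypercube n - B. F y)"
      then obtain y where y: "y \<in> hypercube n - B" "\<omega> \<in> F y" by blast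
      have "Y j \<omega> \<notin> B" if "k < j" "j \<le> k + Suc l" for j
        using y that by (cases "j = Suc k") (auto simp: F_def)
      moreover have "Y i \<omega> = z i" if "i \<le> k" for i
        using y that by (auto simp: F_def dest!: spec[of _ i])
      ultimately show "\<omega> \<in> E" using y by (auto simp: E_def F_def)
    qed
    then have "prob E = (\<Sum>y\<in>hypercube n - B. prob (F y))"
    proof (simp only:, intro finite_measure_finite_Union)
      show "disjoint_family_on F (hypercube n - B)"
        unfolding disjoint_family_on_def F_def by (auto dest!: spec[of _ "Suc k"])
      show "F ` (hypercube n - B) \<subseteq> events"
        unfolding F_def by auto
    qed simp
    also have "\<dots> = (\<Sum>y\<in>hypercube n - B. p * (if hamming_dist n (z k) y = 1 then 1 / real n else 0) * avoid n B l y)"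
    proof (rule sum.cong[OF refl])
      fix y assume "y \<in> hypercube n - B"
      then show "prob (F y) = p * (if hamming_dist n (z k) y = 1 then 1 / real n else 0) * avoid n B l y"
        unfolding F_def p_def using Suc.IH[of "Suc k" "z(Suc k := y)"] prob_path_step[of y k z]
        by simp
    qed
    also have "\<dots> = (\<Sum>y\<in>hypercube n. p / real n *
        (if hamming_dist n (z k) y = 1 then if y \<in> B then 0 else avoid n B l y else 0))"
      by (rule sum.mono_neutral_cong_left) auto
    also have "\<dots> = p / real n * (\<Sum>y\<in>{y \<in> hypercube n. hamming_dist n (z k) y = 1}. if y \<in> B then 0 else avoid n B l y)"
      by (simp only: sum_distrib_left[symmetric] sum.inter_filter[OF finite_hypercube])
    also have "\<dots> = p * avoid n B (Suc l) (z k)"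
      using sum_flips_eq_sum_neighbours[OF zk, of "\<lambda>y. if y \<in> B then 0 else avoid n B l y"]
      by (simp add: neighbour_mean_def)
    finally show ?thesis by (simp only: E_def p_def)
  qed
qed

lemma prob_avoid:
  assumes "x \<notin> B" "N \<ge> 1"
  shows "\<P>(\<omega> in M. \<forall>j<N. Y j \<omega> \<notin> B) = avoid n B (N - 1) x"
proof -
  have "AE \<omega> in M. Y 0 \<omega> = x"
    using start by (subst (asm) prob_Collect_eq_1) auto
  then have "\<P>(\<omega> in M. \<forall>j<N. Y j \<omega> \<notin> B)
      = \<P>(\<omega> in M. (\<forall>i\<le>0. Y i \<omega> = x) \<and> (\<forall>j. 0 < j \<and> j \<le> 0 + (N - 1) \<longrightarrow> Y j \<omega> \<notin> B))"
  proof (intro finite_measure_eq_AE)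
    show "AE \<omega> in M. \<omega> \<in> {\<omega> \<in> space M. \<forall>j<N. Y j \<omega> \<notin> B} \<longleftrightarrow>
        \<omega> \<in> {\<omega> \<in> space M. (\<forall>i\<le>0. Y i \<omega> = x) \<and> (\<forall>j. 0 < j \<and> j \<le> 0 + (N - 1) \<longrightarrow> Y j \<omega> \<notin> B)}"
      using \<open>AE \<omega> in M. Y 0 \<omega> = x\<close>
    proof (eventually_elim)
      case (elim \<omega>)
      have "(\<forall>j<N. Y j \<omega> \<notin> B) \<longleftrightarrow> (\<forall>j. 0 < j \<and> j \<le> N - 1 \<longrightarrow> Y j \<omega> \<notin> B)"
      proof (intro iffI allI impI)
        fix j assume *: "\<forall>j. 0 < j \<and> j \<le> N - 1 \<longrightarrow> Y j \<omega> \<notin> B" "j < N"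
        then show "Y j \<omega> \<notin> B" using elim assms(1) by (cases "j = 0") auto
      qed (use assms(2) in auto)
      then show ?case using elim by simp
    qed
  qed auto
  then show ?thesis
    unfolding prob_path_avoid[of 0 "\<lambda>_. x"] using start by simp
qed

text \<open>The hitting time is at least \<open>r\<close> if and only if none of the times \<open>0, \<dots>, \<lceil>r\<rceil> - 1\<close> is a visit. As the
  walk starts outside of \<open>B\<close>, this leaves \<open>\<lceil>r\<rceil> - 1\<close> steps to be survived.\<close>

lemma prob_hitting_time_ge:
  assumes "x \<notin> B" "r > 0"
  shows "\<P>(\<omega> in M. ereal_of_enat (hitting_time Y B \<omega>) \<ge> ereal r) = avoid n B (nat \<lceil>r\<rceil> - 1) x"
proof -
  have "ereal_of_enat (hitting_time Y B \<omega>) \<ge> ereal r \<longleftrightarrow> (\<forall>j<nat \<lceil>r\<rceil>. Y j \<omega> \<notin> B)" for \<omega>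
  proof -
    have le: "ereal r \<le> ereal_of_enat (enat k) \<longleftrightarrow> nat \<lceil>r\<rceil> \<le> k" for k
      by (simp add: nat_le_iff ceiling_le_iff)
    show ?thesis
    proof (cases "{k. Y k \<omega> \<in> B} = {}")
      case True
      then have "hitting_time Y B \<omega> = \<infinity>" by (simp add: hitting_time_def Inf_enat_def)
      with True show ?thesis by auto
    next
      case False
      define m where "m = (LEAST k. Y k \<omega> \<in> B)"
      have m: "Y m \<omega> \<in> B" "\<And>k. Y k \<omega> \<in> B \<Longrightarrow> m \<le> k"
        using False unfolding m_def by (auto intro: LeastI Least_le)
      then have "hitting_time Y B \<omega> = enat m"
        unfolding hitting_time_def by (intro antisym INF_lower2[of m] INF_greatest) auto
      then have "ereal_of_enat (hitting_time Y B \<omega>) \<ge> ereal r \<longleftrightarrow> nat \<lceil>r\<rceil> \<le> m"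
        by (simp only: le)
      also have "\<dots> \<longleftrightarrow> (\<forall>j<nat \<lceil>r\<rceil>. Y j \<omega> \<notin> B)"
        using m by (meson leD le_less_trans not_le)
      finally show ?thesis .
    qed
  qed
  moreover have "nat \<lceil>r\<rceil> \<ge> 1" using assms(2) by linarith
  ultimately show ?thesis using prob_avoid[OF assms(1)] by simp
qed

end

section \<open>Large deviations of the percolation cloud\<close>

context percolation_cloud
begin

text \<open>The sum of \<open>c\<close> over the cloud (see \<open>weight_eq_sum\<close>), written as a linear combination of the
  independent site indicators, so that it is a random variable on the whole space.\<close>

definition weight :: "(bool list \<Rightarrow> real) \<Rightarrow> 'w \<Rightarrow> real" where
  "weight c \<omega> = (\<Sum>y\<in>hypercube n. c y * of_bool (y \<in> A \<omega>))"

lemma site_event: "y \<in> hypercube n \<Longrightarrow> {\<omega> \<in> space M. y \<in> A \<omega>} \<in> events"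
  using sites_indep by (auto simp: indep_events_def)

lemma weight_measurable [measurable]: "weight c \<in> borel_measurable M"
  unfolding weight_def
proof (intro borel_measurable_sum borel_measurable_times borel_measurable_const)
  fix y assume y: "y \<in> hypercube n"
  have "(\<lambda>\<omega>. of_bool (y \<in> A \<omega>) :: real) \<in> borel_measurable M
      \<longleftrightarrow> (indicator {\<omega> \<in> space M. y \<in> A \<omega>} :: _ \<Rightarrow> real) \<in> borel_measurable M"
    by (rule measurable_cong) (simp add: indicator_def)
  then show "(\<lambda>\<omega>. of_bool (y \<in> A \<omega>) :: real) \<in> borel_measurable M"
    using site_event[OF y] by simp
qed

lemma weight_eq_sum:
  assumes "\<omega> \<in> space M"
  shows "weight c \<omega> = sum c (A \<omega>)"
proof -
  have "hypercube n \<inter> A \<omega> = A \<omega>" using subset[OF assms] by blast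
  then show ?thesis by (simp add: weight_def of_bool_def if_distrib sum.If_cases cong: if_cong)
qed

lemma prob_subset_cloud:
  assumes "S \<subseteq> hypercube n"
  shows "{\<omega> \<in> space M. S \<subseteq> A \<omega>} \<in> events" "\<P>(\<omega> in M. S \<subseteq> A \<omega>) = \<rho> ^ card S"
proof -
  have fin: "finite S" using assms by (rule finite_subset) simp
  have "{\<omega> \<in> space M. S \<subseteq> A \<omega>} \<in> events \<and> \<P>(\<omega> in M. S \<subseteq> A \<omega>) = \<rho> ^ card S"
  proof (cases "S = {}")
    case True
    then show ?thesis by (simp add: prob_space)
  next
    case False
    then have eq: "{\<omega> \<in> space M. S \<subseteq> A \<omega>} = (\<Inter>y\<in>S. {\<omega> \<in> space M. y \<in> A \<omega>})" by auto
    have "(\<Inter>y\<in>S. {\<omega> \<in> space M. y \<in> A \<omega>}) \<in> events"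
      using fin False assms by (intro sets.finite_INT) (auto intro: site_event)
    moreover have "prob (\<Inter>y\<in>S. {\<omega> \<in> space M. y \<in> A \<omega>}) = (\<Prod>y\<in>S. prob {\<omega> \<in> space M. y \<in> A \<omega>})"
      using sites_indep fin False assms unfolding indep_events_def by blast
    moreover have "\<dots> = (\<Prod>y\<in>S. \<rho>)"
      using assms by (intro prod.cong) (auto simp: site_prob)
    ultimately show ?thesis by (simp add: eq)
  qed
  then show "{\<omega> \<in> space M. S \<subseteq> A \<omega>} \<in> events" "\<P>(\<omega> in M. S \<subseteq> A \<omega>) = \<rho> ^ card S" by auto
qed

text \<open>Expanding the product of the factors \<open>1 + (exp (c y) - 1) * of_bool (y \<in> A \<omega>)\<close> over the sites yields
  the events \<open>S \<subseteq> A \<omega>\<close>, whose probabilities are known from independence; the same expansion read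
  backwards gives the product formula.\<close>

lemma mgf_weight:
  "integrable M (\<lambda>\<omega>. exp (weight c \<omega>))"
  "expectation (\<lambda>\<omega>. exp (weight c \<omega>)) = (\<Prod>y\<in>hypercube n. 1 + \<rho> * (exp (c y) - 1))"
proof -
  define e where "e S = (\<Prod>y\<in>S. exp (c y) - 1)" for S
  have eq: "exp (weight c \<omega>) = (\<Sum>S\<in>Pow (hypercube n). e S * indicator {\<omega> \<in> space M. S \<subseteq> A \<omega>} \<omega>)"
    if "\<omega> \<in> space M" for \<omega>
  proof -
    have "exp (weight c \<omega>) = (\<Prod>y\<in>hypercube n. 1 + (exp (c y) - 1) * of_bool (y \<in> A \<omega>))"
      unfolding weight_def exp_sum[OF finite_hypercube] by (intro prod.cong) auto
    also have "\<dots> = (\<Sum>S\<in>Pow (hypercube n). \<Prod>y\<in>S. (exp (c y) - 1) * of_bool (y \<in> A \<omega>))"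
      by (rule sum_Pow_prod[symmetric]) simp
    also have "\<dots> = (\<Sum>S\<in>Pow (hypercube n). e S * indicator {\<omega> \<in> space M. S \<subseteq> A \<omega>} \<omega>)"
    proof (rule sum.cong[OF refl])
      fix S assume "S \<in> Pow (hypercube n)"
      then have fin: "finite S" using finite_subset[OF _ finite_hypercube] by blast
      show "(\<Prod>y\<in>S. (exp (c y) - 1) * of_bool (y \<in> A \<omega>)) = e S * indicator {\<omega> \<in> space M. S \<subseteq> A \<omega>} \<omega>"
      proof (cases "S \<subseteq> A \<omega>")
        case True
        then have "(\<Prod>y\<in>S. (exp (c y) - 1) * of_bool (y \<in> A \<omega>)) = e S"
          unfolding e_def by (intro prod.cong) auto
        then show ?thesis using True that by simp
      next
        case False
        then show ?thesis using fin by (auto intro!: prod_zero)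
      qed
    qed
    finally show ?thesis .
  qed
  have int: "integrable M (\<lambda>\<omega>. \<Sum>S\<in>Pow (hypercube n). e S * indicator {\<omega> \<in> space M. S \<subseteq> A \<omega>} \<omega>)"
    by (intro Bochner_Integration.integrable_sum integrable_mult_right integrable_real_indicator prob_subset_cloud(1))
      (auto simp: emeasure_eq_measure)
  show "integrable M (\<lambda>\<omega>. exp (weight c \<omega>))"
    using int by (subst Bochner_Integration.integrable_cong[OF refl eq]) auto
  have "expectation (\<lambda>\<omega>. exp (weight c \<omega>))
      = expectation (\<lambda>\<omega>. \<Sum>S\<in>Pow (hypercube n). e S * indicator {\<omega> \<in> space M. S \<subseteq> A \<omega>} \<omega>)"
    by (rule Bochner_Integration.integral_cong[OF refl eq])
  also have "\<dots> = (\<Sum>S\<in>Pow (hypercube n). e S * \<P>(\<omega> in M. S \<subseteq> A \<omega>))"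
  proof (subst Bochner_Integration.integral_sum)
    fix S assume "S \<in> Pow (hypercube n)"
    then show "integrable M (\<lambda>\<omega>. e S * indicator {\<omega> \<in> space M. S \<subseteq> A \<omega>} \<omega>)"
      by (intro integrable_mult_right integrable_real_indicator prob_subset_cloud(1))
        (auto simp: emeasure_eq_measure)
  next
    show "(\<Sum>S\<in>Pow (hypercube n). expectation (\<lambda>\<omega>. e S * indicator {\<omega> \<in> space M. S \<subseteq> A \<omega>} \<omega>))
        = (\<Sum>S\<in>Pow (hypercube n). e S * \<P>(\<omega> in M. S \<subseteq> A \<omega>))"
      by (intro sum.cong refl) (simp add: prob_subset_cloud(1))
  qed
  also have "\<dots> = (\<Sum>S\<in>Pow (hypercube n). \<Prod>y\<in>S. \<rho> * (exp (c y) - 1))"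
    by (intro sum.cong refl) (auto simp: prob_subset_cloud(2) e_def prod.distrib mult.commute)
  also have "\<dots> = (\<Prod>y\<in>hypercube n. 1 + \<rho> * (exp (c y) - 1))"
    by (rule sum_Pow_prod) simp
  finally show "expectation (\<lambda>\<omega>. exp (weight c \<omega>)) = (\<Prod>y\<in>hypercube n. 1 + \<rho> * (exp (c y) - 1))" .
qed

text \<open>Chernoff's bound, with \<open>1 + u \<le> exp u\<close> applied to each factor of the moment generating function.\<close>

lemma prob_weight_ge:
  "\<P>(\<omega> in M. weight c \<omega> \<ge> t) \<le> exp (\<rho> * (\<Sum>y\<in>hypercube n. exp (c y) - 1) - t)"
proof -
  have "\<P>(\<omega> in M. weight c \<omega> \<ge> t) = \<P>(\<omega> in M. exp (weight c \<omega>) \<ge> exp t)" by simp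
  also have "\<dots> \<le> expectation (\<lambda>\<omega>. exp (weight c \<omega>)) / exp t"
    by (rule integral_Markov_inequality_measure[OF mgf_weight(1), where A = "{}"]) auto
  also have "expectation (\<lambda>\<omega>. exp (weight c \<omega>)) \<le> (\<Prod>y\<in>hypercube n. exp (\<rho> * (exp (c y) - 1)))"
    unfolding mgf_weight(2)
  proof (intro prod_mono conjI)
    fix y
    have "0 \<le> (1 - \<rho>) + \<rho> * exp (c y)" using density by simp
    also have "\<dots> = 1 + \<rho> * (exp (c y) - 1)" by (simp add: algebra_simps)
    finally show "0 \<le> 1 + \<rho> * (exp (c y) - 1)" .
  qed simp
  also have "\<dots> = exp (\<rho> * (\<Sum>y\<in>hypercube n. exp (c y) - 1))"
    by (simp add: exp_sum sum_distrib_left)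
  finally show ?thesis by (simp add: exp_diff divide_right_mono)
qed

text \<open>Chernoff's bound for both tails, with the constant weights \<open>\<epsilon>/2\<close> and \<open>-\<epsilon>/2\<close>; this choice
  optimises the quadratic bound \<open>exp t \<le> 1 + t + t\<^sup>2\<close>.\<close>

lemma prob_size_deviates:
  assumes "0 < \<epsilon>" "\<epsilon> \<le> 1"
  shows "\<P>(\<omega> in M. \<bar>real (card (A \<omega>)) - \<rho> * 2 ^ n\<bar> \<ge> \<epsilon> * (\<rho> * 2 ^ n)) \<le> 2 * exp (- (\<epsilon> ^ 2 / 4) * (\<rho> * 2 ^ n))"
proof -
  define \<mu> where "\<mu> = \<rho> * 2 ^ n"
  have \<mu>: "\<mu> \<ge> 0" using density by (simp add: \<mu>_def)
  have card: "weight (\<lambda>_. c) \<omega> = c * card (A \<omega>)" if "\<omega> \<in> space M" for c \<omega>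
    using weight_eq_sum[OF that] by simp
  have tail: "\<P>(\<omega> in M. weight (\<lambda>_. t) \<omega> \<ge> t * \<mu> + \<epsilon> / 2 * (\<epsilon> * \<mu>)) \<le> exp (- (\<epsilon> ^ 2 / 4) * \<mu>)"
    if t: "\<bar>t\<bar> = \<epsilon> / 2" for t
  proof -
    have t2: "t ^ 2 = \<epsilon> ^ 2 / 4" using arg_cong[OF t, of "\<lambda>u. u ^ 2"] by (simp add: power_divide)
    have "exp t - 1 \<le> t + t ^ 2" using exp_le_quadratic[of t] t assms by simp
    then have "\<mu> * (exp t - 1) \<le> \<mu> * (t + t ^ 2)" using \<mu> by (rule mult_left_mono)
    then have "\<rho> * (\<Sum>y\<in>hypercube n. exp t - 1) - (t * \<mu> + \<epsilon> / 2 * (\<epsilon> * \<mu>)) \<le> - (\<epsilon> ^ 2 / 4) * \<mu>"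
      unfolding t2 by (simp add: card_hypercube \<mu>_def algebra_simps power2_eq_square)
    then show ?thesis
      using prob_weight_ge[of "t * \<mu> + \<epsilon> / 2 * (\<epsilon> * \<mu>)" "\<lambda>_. t"] by (meson exp_le_cancel_iff order_trans)
  qed
  have "{\<omega> \<in> space M. \<bar>real (card (A \<omega>)) - \<mu>\<bar> \<ge> \<epsilon> * \<mu>}
      \<subseteq> {\<omega> \<in> space M. weight (\<lambda>_. \<epsilon> / 2) \<omega> \<ge> \<epsilon> / 2 * \<mu> + \<epsilon> / 2 * (\<epsilon> * \<mu>)}
       \<union> {\<omega> \<in> space M. weight (\<lambda>_. - (\<epsilon> / 2)) \<omega> \<ge> - (\<epsilon> / 2) * \<mu> + \<epsilon> / 2 * (\<epsilon> * \<mu>)}" (is "?E \<subseteq> ?F \<union> ?G")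
  proof
    fix \<omega> assume \<omega>: "\<omega> \<in> ?E"
    then have "\<epsilon> * \<mu> \<le> real (card (A \<omega>)) - \<mu> \<or> \<epsilon> * \<mu> \<le> \<mu> - real (card (A \<omega>))" by auto
    then have "\<epsilon> / 2 * (\<epsilon> * \<mu>) \<le> \<epsilon> / 2 * (real (card (A \<omega>)) - \<mu>) \<or>
        \<epsilon> / 2 * (\<epsilon> * \<mu>) \<le> \<epsilon> / 2 * (\<mu> - real (card (A \<omega>)))"
      using assms(1) by (auto intro: mult_left_mono)
    then show "\<omega> \<in> ?F \<union> ?G" using \<omega> by (auto simp: card algebra_simps)
  qed
  then have "prob ?E \<le> prob (?F \<union> ?G)" by (intro finite_measure_mono) auto
  also have "\<dots> \<le> prob ?F + prob ?G" by (intro measure_Un_le) auto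
  also have "\<dots> \<le> 2 * exp (- (\<epsilon> ^ 2 / 4) * \<mu>)"
    using tail[of "\<epsilon> / 2"] tail[of "- (\<epsilon> / 2)"] assms by simp
  finally show ?thesis by (simp add: \<mu>_def)
qed

lemma visits_cloud:
  assumes "\<omega> \<in> space M"
  shows "visits n (A \<omega>) s z = weight (\<lambda>y. \<Sum>j=1..s. trans_prob n j z y) \<omega>"
  unfolding visits_def weight_eq_sum[OF assms] ..

text \<open>The expected number of visits to the cloud up to time \<open>s\<close> is a weight whose coefficients are at most
  \<open>4325/n\<close> and sum to \<open>s\<close>. Multiplied by \<open>C n\<close> the coefficients stay bounded, so that its exponential
  moment is at most \<open>exp (n * O(\<rho> s))\<close>, whereas the threshold \<open>\<epsilon>\<close> becomes \<open>3n\<close>. As long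
  as \<open>\<rho> s\<close> is small, the resulting bound is close enough to \<open>exp (- 3n)\<close> to outweigh
  the number \<open>2\<^sup>n\<close> of starting points.\<close>

lemma prob_many_visits:
  assumes n: "n \<ge> 1" and s: "s \<le> n ^ 2" and \<epsilon>: "\<epsilon> > 0"
  defines "C \<equiv> 3 / \<epsilon>"
  shows "\<P>(\<omega> in M. \<exists>z\<in>hypercube n. visits n (A \<omega>) s z \<ge> \<epsilon>)
    \<le> exp (real n * (C * exp (4325 * C) * (\<rho> * s) - 2))"
proof -
  have C: "C > 0" using \<epsilon> by (simp add: C_def)
  have one: "\<P>(\<omega> in M. visits n (A \<omega>) s z \<ge> \<epsilon>) \<le> exp (real n * (C * exp (4325 * C) * (\<rho> * s) - 3))"
    if z: "z \<in> hypercube n" for z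
  proof -
    define g where "g y = (\<Sum>j=1..s. trans_prob n j z y)" for y
    have g: "0 \<le> g y" "y \<in> hypercube n \<Longrightarrow> g y \<le> 4325 / n" for y
      unfolding g_def using sum_trans_prob_short[OF n z _ s] by (auto intro: sum_nonneg trans_prob_nonneg)
    have sum_g: "(\<Sum>y\<in>hypercube n. g y) = s"
      unfolding g_def by (subst sum.swap) (simp add: sum_trans_prob[OF n z] del: trans_prob.simps)
    have expm1: "exp (C * n * g y) - 1 \<le> exp (4325 * C) * (C * n) * g y" if y: "y \<in> hypercube n" for y
    proof -
      define u where "u = C * n * g y"
      have "u \<le> C * n * (4325 / n)"
        unfolding u_def using C g(2)[OF y] by (intro mult_left_mono) auto
      then have u: "0 \<le> u" "u \<le> 4325 * C"
        using n C g(1)[of y] by (auto simp: u_def)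
      have "1 - u \<le> exp (- u)" using exp_ge_add_one_self[of "- u"] by simp
      then have "exp u * (1 - u) \<le> exp u * exp (- u)" by (intro mult_left_mono) auto
      then have "exp u - 1 \<le> exp u * u" by (simp add: exp_minus algebra_simps)
      also have "\<dots> \<le> exp (4325 * C) * u" using u by (intro mult_right_mono) auto
      finally show ?thesis by (simp add: u_def mult_ac)
    qed
    have "\<P>(\<omega> in M. visits n (A \<omega>) s z \<ge> \<epsilon>) = \<P>(\<omega> in M. weight (\<lambda>y. C * n * g y) \<omega> \<ge> 3 * n)"
    proof (intro arg_cong[where f = prob] Collect_cong conj_cong refl)
      fix \<omega> assume "\<omega> \<in> space M"
      then have "weight (\<lambda>y. C * n * g y) \<omega> = C * n * visits n (A \<omega>) s z"
        by (simp add: weight_eq_sum visits_def g_def sum_distrib_left)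
      moreover have "real (3 * n) = C * n * \<epsilon>" using \<epsilon> by (simp add: C_def)
      moreover have "C * n > 0" using C n by simp
      ultimately show "visits n (A \<omega>) s z \<ge> \<epsilon> \<longleftrightarrow> weight (\<lambda>y. C * n * g y) \<omega> \<ge> 3 * n"
        by (simp only: mult_le_cancel_left_pos)
    qed
    also have "\<dots> \<le> exp (\<rho> * (\<Sum>y\<in>hypercube n. exp (C * n * g y) - 1) - 3 * n)"
      by (rule prob_weight_ge)
    also have "\<dots> \<le> exp (real n * (C * exp (4325 * C) * (\<rho> * s) - 3))"
    proof -
      have "(\<Sum>y\<in>hypercube n. exp (C * n * g y) - 1) \<le> (\<Sum>y\<in>hypercube n. exp (4325 * C) * (C * n) * g y)"
        by (intro sum_mono expm1)
      also have "\<dots> = exp (4325 * C) * (C * n) * s"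
        unfolding sum_distrib_left[symmetric] sum_g ..
      finally have "\<rho> * (\<Sum>y\<in>hypercube n. exp (C * n * g y) - 1) \<le> \<rho> * (exp (4325 * C) * (C * n) * s)"
        using density by (intro mult_left_mono) auto
      then show ?thesis by (simp add: algebra_simps)
    qed
    finally show ?thesis .
  qed
  have "{\<omega> \<in> space M. \<exists>z\<in>hypercube n. visits n (A \<omega>) s z \<ge> \<epsilon>}
      = (\<Union>z\<in>hypercube n. {\<omega> \<in> space M. visits n (A \<omega>) s z \<ge> \<epsilon>})" by auto
  also have "prob \<dots> \<le> (\<Sum>z\<in>hypercube n. \<P>(\<omega> in M. visits n (A \<omega>) s z \<ge> \<epsilon>))"
  proof (intro finite_measure_subadditive_finite image_subsetI)
    fix z
    have "{\<omega> \<in> space M. visits n (A \<omega>) s z \<ge> \<epsilon>}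
        = {\<omega> \<in> space M. weight (\<lambda>y. \<Sum>j=1..s. trans_prob n j z y) \<omega> \<ge> \<epsilon>}"
      using visits_cloud by auto
    then show "{\<omega> \<in> space M. visits n (A \<omega>) s z \<ge> \<epsilon>} \<in> events" by simp
  qed simp
  also have "\<dots> \<le> (\<Sum>z\<in>hypercube n. exp (real n * (C * exp (4325 * C) * (\<rho> * s) - 3)))"
    by (intro sum_mono one)
  also have "\<dots> = 2 ^ n * exp (real n * (C * exp (4325 * C) * (\<rho> * s) - 3))"
    by (simp add: card_hypercube)
  also have "\<dots> \<le> exp 1 ^ n * exp (real n * (C * exp (4325 * C) * (\<rho> * s) - 3))"
    using exp_ge_add_one_self[of 1] by (intro mult_right_mono power_mono) auto
  also have "\<dots> = exp (real n * (C * exp (4325 * C) * (\<rho> * s) - 2))"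
    by (simp add: exp_of_nat_mult[symmetric] exp_add[symmetric] algebra_simps)
  finally show ?thesis .
qed

lemma events_cloud:
  "{\<omega> \<in> space M. \<bar>real (card (A \<omega>)) - r\<bar> \<ge> t} \<in> events"
  "{\<omega> \<in> space M. \<exists>z\<in>hypercube n. visits n (A \<omega>) s z \<ge> t} \<in> events"
proof -
  have "{\<omega> \<in> space M. \<bar>real (card (A \<omega>)) - r\<bar> \<ge> t} = {\<omega> \<in> space M. \<bar>weight (\<lambda>_. 1) \<omega> - r\<bar> \<ge> t}"
    using weight_eq_sum by auto
  then show "{\<omega> \<in> space M. \<bar>real (card (A \<omega>)) - r\<bar> \<ge> t} \<in> events" by simp
  have "{\<omega> \<in> space M. \<exists>z\<in>hypercube n. visits n (A \<omega>) s z \<ge> t}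
      = (\<Union>z\<in>hypercube n. {\<omega> \<in> space M. weight (\<lambda>y. \<Sum>j=1..s. trans_prob n j z y) \<omega> \<ge> t})"
    using visits_cloud by auto
  then show "{\<omega> \<in> space M. \<exists>z\<in>hypercube n. visits n (A \<omega>) s z \<ge> t} \<in> events"
    by (auto intro!: sets.finite_UN)
qed

end

section \<open>Exponential hitting times of regular sets\<close>

definition mixing_time :: "nat \<Rightarrow> nat" where
  "mixing_time n = nat \<lceil>real n * ln (real n)\<rceil>"

lemma mixing_time_ge: "real n * ln (real n) \<le> real (mixing_time n)"
  by (simp add: mixing_time_def real_nat_ceiling_ge)

lemma mixing_time_le_square:
  assumes "n \<ge> 1" shows "mixing_time n \<le> n ^ 2"
proof -
  have "real n * ln (real n) \<le> real n * real n"
    using assms ln_le_minus_one[of "real n"] by (intro mult_left_mono) auto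
  then have "\<lceil>real n * ln (real n)\<rceil> \<le> int (n ^ 2)"
    by (simp add: ceiling_le_iff power2_eq_square)
  then show ?thesis by (simp add: mixing_time_def nat_le_iff)
qed

lemma mixing_time_le_plus_one:
  assumes "n \<ge> 1" shows "real (mixing_time n) \<le> real n * ln (real n) + 1"
proof -
  have "0 \<le> real n * ln (real n)" using assms by simp
  then show ?thesis unfolding mixing_time_def by linarith
qed

lemma one_le_ln: "n \<ge> 3 \<Longrightarrow> 1 \<le> ln (real n)"
  using exp_le by (subst ln_ge_iff) auto

lemma visits_subset: "finite A \<Longrightarrow> B \<subseteq> A \<Longrightarrow> visits n B k z \<le> visits n A k z"
  unfolding visits_def by (intro sum_mono2 sum_nonneg trans_prob_nonneg)

text \<open>The deterministic properties of a realisation of the clouds from which the exponential law follows.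
  The last assumption forbids clusters: from no starting point are many visits expected before the walk
  has mixed.\<close>

locale regular_sets =
  fixes m :: "nat \<Rightarrow> real" and A :: "nat \<Rightarrow> bool list set"
  assumes m_pos: "\<And>n. n \<ge> 1 \<Longrightarrow> m n > 0"
    and inverse_m: "(\<lambda>n. 1 / m n) \<longlonglongrightarrow> 0"
    and mixing_m: "(\<lambda>n. mixing_time n / m n) \<longlonglongrightarrow> 0"
    and m_volume: "(\<lambda>n. m n / 2 ^ n) \<longlonglongrightarrow> 0"
    and subset: "\<And>n. n \<ge> 1 \<Longrightarrow> A n \<subseteq> hypercube n"
    and size: "(\<lambda>n. card (A n) * m n / 2 ^ n) \<longlonglongrightarrow> 1"
    and scattered: "\<And>\<epsilon>. \<epsilon> > 0 \<Longrightarrow>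
      eventually (\<lambda>n. \<forall>z\<in>hypercube n. visits n (A n) (mixing_time n) z < \<epsilon>) sequentially"
begin

text \<open>The visits before mixing are negligible by \<open>scattered\<close>, and the mixing time is a negligible part of
  \<open>T n\<close>; during the rest a step is a visit with probability about
  \<open>card (A n) / 2\<^sup>n \<approx> 1 / m n\<close>, on average over two consecutive times. Removing \<open>x\<close> changes the size by at most \<open>1\<close>, which is negligible
  against \<open>2\<^sup>n / m n\<close>. The upper limit \<open>U\<close> and the lower limit \<open>L\<close> make this precise, uniformly in both
  points.\<close>

lemma visits_limit:
  fixes T :: "nat \<Rightarrow> nat"
  assumes T: "(\<lambda>n. T n / m n) \<longlonglongrightarrow> \<delta>" and \<delta>: "\<delta> > 0" and \<epsilon>: "\<epsilon> > 0"
  shows "eventually (\<lambda>n. \<forall>x\<in>hypercube n. \<forall>z\<in>hypercube n.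
    \<bar>visits n (A n - {x}) (T n) z - \<delta>\<bar> \<le> \<epsilon>) sequentially"
proof -
  have inv_n: "(\<lambda>n. 4 / real n) \<longlonglongrightarrow> 0" by (rule lim_const_over_n)
  define U where "U n = (T n / m n + 1 / m n) * (card (A n) * m n / 2 ^ n) * (1 + 4 / real n)" for n
  define D where "D n = T n / m n - mixing_time n / m n - 1 / m n" for n
  define L where "L n = D n * ((card (A n) * m n / 2 ^ n - m n / 2 ^ n) * (1 - 4 / real n))" for n
  have "U \<longlonglongrightarrow> (\<delta> + 0) * 1 * (1 + 0)"
    unfolding U_def by (intro tendsto_intros T inverse_m size inv_n)
  then have U: "eventually (\<lambda>n. U n < \<delta> + \<epsilon> / 2) sequentially"
    by (rule order_tendstoD) (use \<epsilon> in simp)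
  have D_lim: "D \<longlonglongrightarrow> \<delta> - 0 - 0"
    unfolding D_def by (intro tendsto_intros T inverse_m mixing_m)
  then have D: "eventually (\<lambda>n. D n > 0) sequentially"
    by (rule order_tendstoD) (use \<delta> in simp)
  have "L \<longlonglongrightarrow> (\<delta> - 0 - 0) * ((1 - 0) * (1 - 0))"
    unfolding L_def by (intro tendsto_intros D_lim m_volume size inv_n)
  then have L: "eventually (\<lambda>n. L n > \<delta> - \<epsilon>) sequentially"
    by (rule order_tendstoD) (use \<epsilon> in simp)
  have "eventually (\<lambda>n. \<forall>z\<in>hypercube n. visits n (A n) (mixing_time n) z < \<epsilon> / 2) sequentially"
    using \<epsilon> by (intro scattered) simp
  with U D L eventually_ge_at_top[of 4] show ?thesis
  proof eventually_elim
    case (elim n)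
    then have m: "m n > 0" using m_pos[of n] by simp
    have fin: "finite (A n)" using subset[of n] elim by (auto intro: finite_subset[OF _ finite_hypercube])
    have "D n * m n = real (T n) - real (mixing_time n) - 1"
      using m by (simp add: D_def field_simps)
    moreover have "D n * m n > 0" using elim m by simp
    ultimately have T_ge: "mixing_time n \<le> T n" by linarith
    show ?case
    proof (intro ballI)
      fix x z assume x: "x \<in> hypercube n" and z: "z \<in> hypercube n"
      define B where "B = A n - {x}"
      have B: "B \<subseteq> hypercube n" using subset[of n] elim by (auto simp: B_def)
      have card_le: "card B \<le> card (A n)" unfolding B_def using fin by (intro card_mono) auto
      have card_ge: "real (card (A n)) - 1 \<le> real (card B)"
        unfolding B_def using fin by (cases "x \<in> A n") auto
      have "visits n B (T n) z \<le> visits n B (mixing_time n) z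
          + (real (T n) + 1) * (card B / 2 ^ n * (1 + 4 / n))"
        using elim by (intro visits_bounds(1)[OF _ z B mixing_time_ge T_ge])
      also have "\<dots> \<le> visits n (A n) (mixing_time n) z
          + (real (T n) + 1) * (card (A n) / 2 ^ n * (1 + 4 / n))"
        using fin card_le unfolding B_def
        by (intro add_mono visits_subset mult_left_mono mult_right_mono divide_right_mono) auto
      also have "(real (T n) + 1) * (card (A n) / 2 ^ n * (1 + 4 / n)) = U n"
        using m elim unfolding U_def by (simp add: field_simps)
      finally have up: "visits n B (T n) z \<le> \<delta> + \<epsilon>"
        using elim(1) elim(5)[rule_format, OF z] by linarith
      have "L n = (real (T n) - real (mixing_time n) - 1) * ((real (card (A n)) - 1) / 2 ^ n * (1 - 4 / n))"
        unfolding \<open>D n * m n = _\<close>[symmetric] L_def by (simp add: diff_divide_distrib algebra_simps)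
      also have "\<dots> \<le> (real (T n) - real (mixing_time n) - 1) * (card B / 2 ^ n * (1 - 4 / n))"
        using card_ge \<open>D n * m n = _\<close> \<open>D n * m n > 0\<close> elim
        by (intro mult_left_mono mult_right_mono divide_right_mono) auto
      also have "\<dots> \<le> visits n B (T n) z"
        using elim by (intro visits_bounds(2)[OF _ z B mixing_time_ge T_ge])
      finally have low: "\<delta> - \<epsilon> \<le> visits n B (T n) z" using elim by linarith
      show "\<bar>visits n (A n - {x}) (T n) z - \<delta>\<bar> \<le> \<epsilon>"
        using up low unfolding B_def by linarith
    qed
  qed
qed

text \<open>Cut the time \<open>a * m n\<close> into \<open>K\<close> blocks of length about \<open>\<delta> * m n\<close> with \<open>\<delta> = a/K\<close>. In the limit
  \<open>n \<rightarrow> \<infinity>\<close> the block bounds become \<open>(1 - a/K)\<^sup>K\<close> and \<open>(1 + a/K) powr (- K)\<close>, and both of them tend to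
  \<open>exp (- a)\<close> as \<open>K \<rightarrow> \<infinity>\<close>.\<close>

lemma avoid_limit:
  assumes a: "a > 0" and \<epsilon>: "\<epsilon> > 0"
  shows "eventually (\<lambda>n. \<forall>x\<in>hypercube n.
    \<bar>avoid n (A n - {x}) (nat \<lceil>a * m n\<rceil> - 1) x - exp (- a)\<bar> \<le> \<epsilon>) sequentially"
proof -
  have "(\<lambda>K. (1 + (- a) / real K) ^ K) \<longlonglongrightarrow> exp (- a)"
    by (rule tendsto_exp_limit_sequentially)
  then have low: "eventually (\<lambda>K. (1 + (- a) / real K) ^ K > exp (- a) - \<epsilon>) sequentially"
    by (rule order_tendstoD) (use \<epsilon> in simp)
  have "(\<lambda>K. inverse ((1 + a / real K) ^ K)) \<longlonglongrightarrow> inverse (exp a)"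
    by (intro tendsto_inverse tendsto_exp_limit_sequentially) simp
  then have up: "eventually (\<lambda>K. inverse ((1 + a / real K) ^ K) < exp (- a) + \<epsilon>) sequentially"
    by (rule order_tendstoD) (use \<epsilon> in \<open>simp add: exp_minus\<close>)
  have large: "eventually (\<lambda>K. a < real K) sequentially"
    using filterlim_real_sequentially by (auto simp: filterlim_at_top_dense)
  from eventually_conj[OF low eventually_conj[OF up large]]
  obtain K :: nat where K: "(1 + (- a) / real K) ^ K > exp (- a) - \<epsilon>"
    "inverse ((1 + a / real K) ^ K) < exp (- a) + \<epsilon>" "a < real K"
    using eventually_happens'[OF sequentially_bot] by blast
  define \<delta> where "\<delta> = a / real K"
  have K0: "real K > 0" using K(3) a by linarith
  have \<delta>: "0 < \<delta>" "\<delta> < 1" using a K(3) K0 by (auto simp: \<delta>_def)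
  have "((\<lambda>\<eta>. (1 - (\<delta> + \<eta>)) ^ K) \<longlongrightarrow> (1 - (\<delta> + 0)) ^ K) (at_right 0)"
    by (intro tendsto_intros)
  then have ev1: "eventually (\<lambda>\<eta>. (1 - (\<delta> + \<eta>)) ^ K > exp (- a) - \<epsilon>) (at_right 0)"
    by (rule order_tendstoD) (use K(1) in \<open>simp add: \<delta>_def\<close>)
  have "((\<lambda>\<eta>. (1 - (\<delta> - \<eta>) / (1 + \<delta> + \<eta>)) ^ K) \<longlongrightarrow> (1 - (\<delta> - 0) / (1 + \<delta> + 0)) ^ K) (at_right 0)"
    by (intro tendsto_intros) (use \<delta> in auto)
  moreover have "(1 - (\<delta> - 0) / (1 + \<delta> + 0)) ^ K = inverse ((1 + a / real K) ^ K)"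
    using \<delta>(1) unfolding \<delta>_def[symmetric]
    by (simp add: power_inverse[symmetric] field_simps)
  ultimately have ev2: "eventually (\<lambda>\<eta>. (1 - (\<delta> - \<eta>) / (1 + \<delta> + \<eta>)) ^ K < exp (- a) + \<epsilon>) (at_right 0)"
    using K(2) by (intro order_tendstoD(2)) auto
  have ev3: "eventually (\<lambda>\<eta>. \<eta> < 1 - \<delta>) (at_right 0)"
    using \<delta> by (intro eventually_at_rightI[of 0 "1 - \<delta>"]) auto
  have ev4: "eventually (\<lambda>\<eta>::real. \<eta> > 0) (at_right 0)"
    by (rule eventually_at_right_less)
  obtain \<eta> where \<eta>: "(1 - (\<delta> + \<eta>)) ^ K > exp (- a) - \<epsilon>"
    "(1 - (\<delta> - \<eta>) / (1 + \<delta> + \<eta>)) ^ K < exp (- a) + \<epsilon>" "\<eta> < 1 - \<delta>" "\<eta> > 0"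
    using eventually_happens'[OF _ eventually_conj[OF ev1 eventually_conj[OF ev2 eventually_conj[OF ev3 ev4]]]]
    by auto
  \<comment> \<open>Blocks of length \<open>T n\<close> cover the time interval, and blocks of length \<open>T n - 1\<close> fit into it.\<close>
  define T where "T n = nat \<lceil>\<delta> * m n\<rceil>" for n
  have T_bounds: "\<delta> * m n \<le> T n" "T n \<le> \<delta> * m n + 1" if "n \<ge> 1" for n
  proof -
    have "0 < \<delta> * m n" using \<delta> m_pos[OF that] by simp
    then show "\<delta> * m n \<le> T n" "T n \<le> \<delta> * m n + 1" unfolding T_def by linarith+
  qed
  have T_lim: "(\<lambda>n. T n / m n) \<longlonglongrightarrow> \<delta>" "(\<lambda>n. (T n - 1 :: nat) / m n) \<longlonglongrightarrow> \<delta>"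
  proof -
    have upper: "(\<lambda>n. \<delta> + 1 / m n) \<longlonglongrightarrow> \<delta> + 0" and lower: "(\<lambda>n. \<delta> - 1 / m n) \<longlonglongrightarrow> \<delta> - 0"
      by (intro tendsto_intros inverse_m)+
    have *: "\<delta> - 1 / m n \<le> (T n - 1 :: nat) / m n \<and> (T n - 1 :: nat) / m n \<le> T n / m n
        \<and> T n / m n \<le> \<delta> + 1 / m n" if "n \<ge> 1" for n
    proof (intro conjI)
      have m: "m n > 0" using m_pos[OF that] .
      have "\<delta> * m n - 1 \<le> real (T n - 1)" using T_bounds[OF that] by linarith
      then show "\<delta> - 1 / m n \<le> (T n - 1 :: nat) / m n"
        using m by (simp add: pos_le_divide_eq left_diff_distrib)
      show "(T n - 1 :: nat) / m n \<le> T n / m n" using m by (intro divide_right_mono) auto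
      show "T n / m n \<le> \<delta> + 1 / m n" using m T_bounds[OF that] by (simp add: field_simps)
    qed
    show "(\<lambda>n. T n / m n) \<longlonglongrightarrow> \<delta>" "(\<lambda>n. (T n - 1 :: nat) / m n) \<longlonglongrightarrow> \<delta>"
      using upper lower
      by (auto intro!: tendsto_sandwich[OF _ _ lower[simplified] upper[simplified]]
          eventually_sequentiallyI[of 1] dest!: * intro: order_trans)
  qed
  have "eventually (\<lambda>n. \<forall>x\<in>hypercube n. \<forall>z\<in>hypercube n. \<bar>visits n (A n - {x}) (T n) z - \<delta>\<bar> \<le> \<eta>) sequentially"
    by (rule visits_limit[OF T_lim(1) \<delta>(1) \<eta>(4)])
  moreover have "eventually (\<lambda>n. \<forall>x\<in>hypercube n. \<forall>z\<in>hypercube n. \<bar>visits n (A n - {x}) (T n - 1) z - \<delta>\<bar> \<le> \<eta>) sequentially"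
    by (rule visits_limit[OF T_lim(2) \<delta>(1) \<eta>(4)])
  ultimately show ?thesis using eventually_ge_at_top[of 1]
  proof eventually_elim
    case (elim n)
    define N where "N = nat \<lceil>a * m n\<rceil> - 1"
    have m: "m n > 0" using m_pos elim by simp
    have am: "a * m n = K * (\<delta> * m n)" using K0 by (simp add: \<delta>_def)
    have "a * m n \<le> real K * real (T n)"
      unfolding am using T_bounds[of n] elim K0 by (intro mult_left_mono) auto
    then have "\<lceil>a * m n\<rceil> \<le> int (K * T n)" by (simp add: ceiling_le_iff)
    then have N_le: "N \<le> K * T n" unfolding N_def by linarith
    have N_ge: "K * (T n - 1) \<le> N"
    proof -
      have "real (T n - 1) < \<delta> * m n"
        using mult_pos_pos[OF \<delta>(1) m] unfolding T_def by linarith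
      then have "real K * real (T n - 1) < a * m n"
        unfolding am using K0 by (intro mult_strict_left_mono)
      then have "int (K * (T n - 1)) < \<lceil>a * m n\<rceil>" by (simp add: less_ceiling_iff)
      then show ?thesis unfolding N_def by linarith
    qed
    show ?case
    proof
      fix x assume x: "x \<in> hypercube n"
      have fin: "finite (A n - {x})"
        using subset[OF elim(3)] by (auto intro: finite_subset[OF _ finite_hypercube])
      have "exp (- a) - \<epsilon> \<le> (1 - (\<delta> + \<eta>)) ^ K" using \<eta>(1) by simp
      also have "\<dots> \<le> avoid n (A n - {x}) (K * T n) x"
        by (rule avoid_block_bounds(1)[OF elim(3) fin x]) (use elim(1) x \<eta>(3) in auto)
      also have "\<dots> \<le> avoid n (A n - {x}) N x" by (rule avoid_antimono[OF elim(3) N_le])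
      finally have 1: "exp (- a) - \<epsilon> \<le> avoid n (A n - {x}) N x" .
      have "avoid n (A n - {x}) N x \<le> avoid n (A n - {x}) (K * (T n - 1)) x"
        by (rule avoid_antimono[OF elim(3) N_ge])
      also have "\<dots> \<le> (1 - (\<delta> - \<eta>) / (1 + \<delta> + \<eta>)) ^ K"
        by (rule avoid_block_bounds(2)[OF elim(3) fin x]) (use elim(2) x in auto)
      also have "\<dots> \<le> exp (- a) + \<epsilon>" using \<eta>(2) by simp
      finally have 2: "avoid n (A n - {x}) N x \<le> exp (- a) + \<epsilon>" .
      show "\<bar>avoid n (A n - {x}) (nat \<lceil>a * m n\<rceil> - 1) x - exp (- a)\<bar> \<le> \<epsilon>"
        using 1 2 unfolding N_def by linarith
    qed
  qed
qed

end

section \<open>Almost sure regularity of the clouds\<close>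

text \<open>The growth conditions on \<open>m\<close> say that the walk mixes long before it has made \<open>m n\<close> steps, and that the
  cloud contains many points.\<close>

lemma density_scales:
  fixes m :: "nat \<Rightarrow> real"
  assumes m_pos: "\<And>n. n \<ge> 1 \<Longrightarrow> m n > 0"
    and m_lower: "(\<lambda>n. (real n * ln (real n)) / m n) \<longlonglongrightarrow> 0"
    and m_upper: "(\<lambda>n. m n / (2 ^ n * inverse (ln (real n)))) \<longlonglongrightarrow> 0"
  shows "(\<lambda>n. 1 / m n) \<longlonglongrightarrow> 0" "(\<lambda>n. mixing_time n / m n) \<longlonglongrightarrow> 0"
    "(\<lambda>n. m n / 2 ^ n) \<longlonglongrightarrow> 0"
proof -
  have log: "1 \<le> ln (real n)" "1 \<le> real n * ln (real n)" "m n > 0" if "n \<ge> 3" for n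
  proof -
    show ln: "1 \<le> ln (real n)" by (rule one_le_ln[OF that])
    have "1 * 1 \<le> real n * ln (real n)" using that ln by (intro mult_mono) auto
    then show "1 \<le> real n * ln (real n)" by simp
    show "m n > 0" using m_pos that by simp
  qed
  show inv: "(\<lambda>n. 1 / m n) \<longlonglongrightarrow> 0"
  proof (rule tendsto_sandwich[OF _ _ tendsto_const m_lower])
    show "eventually (\<lambda>n. 0 \<le> 1 / m n) sequentially"
      using log(3) by (auto intro!: eventually_sequentiallyI[of 3] simp: less_imp_le)
    show "eventually (\<lambda>n. 1 / m n \<le> real n * ln (real n) / m n) sequentially"
      using log by (intro eventually_sequentiallyI[of 3] divide_right_mono) (auto simp: less_imp_le)
  qed
  have sum: "(\<lambda>n. real n * ln (real n) / m n + 1 / m n) \<longlonglongrightarrow> 0"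
    using tendsto_add[OF m_lower inv] by simp
  show "(\<lambda>n. mixing_time n / m n) \<longlonglongrightarrow> 0"
  proof (rule tendsto_sandwich[OF _ _ tendsto_const sum])
    show "eventually (\<lambda>n. 0 \<le> mixing_time n / m n) sequentially"
      using log(3) by (auto intro!: eventually_sequentiallyI[of 3] simp: less_imp_le)
    show "eventually (\<lambda>n. mixing_time n / m n \<le> real n * ln (real n) / m n + 1 / m n) sequentially"
    proof (rule eventually_sequentiallyI[of 3])
      fix n :: nat assume n: "3 \<le> n"
      then show "mixing_time n / m n \<le> real n * ln (real n) / m n + 1 / m n"
        using mixing_time_le_plus_one[of n] log(3)[OF n]
        by (simp add: add_divide_distrib[symmetric] divide_right_mono)
    qed
  qed
  show "(\<lambda>n. m n / 2 ^ n) \<longlonglongrightarrow> 0"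
  proof (rule tendsto_sandwich[OF _ _ tendsto_const m_upper])
    show "eventually (\<lambda>n. 0 \<le> m n / 2 ^ n) sequentially"
      using log(3) by (auto intro!: eventually_sequentiallyI[of 3] simp: less_imp_le)
    show "eventually (\<lambda>n. m n / 2 ^ n \<le> m n / (2 ^ n * inverse (ln (real n)))) sequentially"
    proof (rule eventually_sequentiallyI[of 3])
      fix n :: nat assume n: "3 \<le> n"
      have "m n / 2 ^ n * 1 \<le> m n / 2 ^ n * ln (real n)"
        using log[OF n] by (intro mult_left_mono) auto
      then show "m n / 2 ^ n \<le> m n / (2 ^ n * inverse (ln (real n)))"
        by (simp add: divide_inverse mult_ac)
    qed
  qed
qed

text \<open>Borel and Cantelli. The size of the cloud deviates with probability at most
  \<open>2 * exp (- (\<epsilon>\<^sup>2/4) * 2\<^sup>n / m n)\<close>, which is eventually below \<open>2/n\<^sup>2\<close> because \<open>m n\<close> is small compared with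
  \<open>2\<^sup>n / ln n\<close>; clusters occur with probability at most \<open>exp (- n)\<close> because \<open>m n\<close> is large compared with
  \<open>n ln n\<close>.\<close>

lemma eventually_cloud_regular:
  fixes m :: "nat \<Rightarrow> real" and A :: "nat \<Rightarrow> 'o \<Rightarrow> bool list set"
  assumes m_pos: "\<And>n. n \<ge> 1 \<Longrightarrow> m n > 0"
    and m_lower: "(\<lambda>n. (real n * ln (real n)) / m n) \<longlonglongrightarrow> 0"
    and m_upper: "(\<lambda>n. m n / (2 ^ n * inverse (ln (real n)))) \<longlonglongrightarrow> 0"
    and P: "prob_space P"
    and cloud: "\<And>n. n \<ge> 1 \<Longrightarrow> percolation_cloud P n (inverse (m n)) (A n)"
    and \<epsilon>: "0 < \<epsilon>" "\<epsilon> \<le> 1"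
  shows "AE \<omega> in P. eventually (\<lambda>n. \<bar>card (A n \<omega>) - 2 ^ n / m n\<bar> < \<epsilon> * (2 ^ n / m n) \<and>
    (\<forall>z\<in>hypercube n. visits n (A n \<omega>) (mixing_time n) z < \<epsilon>)) sequentially"
proof -
  interpret prob_space P by (rule P)
  define size_bad where "size_bad n = {\<omega> \<in> space P. \<bar>real (card (A n \<omega>)) - inverse (m n) * 2 ^ n\<bar>
    \<ge> \<epsilon> * (inverse (m n) * 2 ^ n)}" for n
  define visits_bad where "visits_bad n = {\<omega> \<in> space P. \<exists>z\<in>hypercube n.
    visits n (A n \<omega>) (mixing_time n) z \<ge> \<epsilon>}" for n
  \<comment> \<open>In dimension \<open>0\<close> nothing is known about the cloud, hence the empty event.\<close>
  define E where "E n = (if n \<ge> 1 then size_bad n \<union> visits_bad n else {})" for n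
  have events: "size_bad n \<in> events" "visits_bad n \<in> events" if "n \<ge> 1" for n
    unfolding size_bad_def visits_bad_def
    by (rule percolation_cloud.events_cloud[OF cloud[OF that]])+
  define C where "C = 3 / \<epsilon>"
  define R where "R = C * exp (4325 * C)"
  have "(\<lambda>n. R * (mixing_time n / m n)) \<longlonglongrightarrow> R * 0"
    by (intro tendsto_intros density_scales(2)[OF m_pos m_lower m_upper])
  then have ev1: "eventually (\<lambda>n. R * (mixing_time n / m n) < 1) sequentially"
    by (rule order_tendstoD) simp
  have ev2: "eventually (\<lambda>n. m n / (2 ^ n * inverse (ln (real n))) < \<epsilon> ^ 2 / 8) sequentially"
    by (rule order_tendstoD(2)[OF m_upper]) (use \<epsilon> in simp)
  have "eventually (\<lambda>n. norm (prob (E n)) \<le> 2 * inverse (real n ^ 2) + exp (- 1) ^ n) sequentially"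
    using ev1 ev2 eventually_ge_at_top[of 3]
  proof eventually_elim
    case (elim n)
    have n: "n \<ge> 1" using elim(3) by simp
    interpret percolation_cloud P n "inverse (m n)" "A n" by (rule cloud[OF n])
    have ln: "ln (real n) \<ge> 1" by (rule one_le_ln[OF elim(3)])
    have m: "m n > 0" by (rule m_pos[OF n])
    have "2 * ln (real n) \<le> \<epsilon> ^ 2 / 4 * (inverse (m n) * 2 ^ n)"
      using elim(2) ln m by (simp add: field_simps)
    then have "exp (- (\<epsilon> ^ 2 / 4) * (inverse (m n) * 2 ^ n)) \<le> exp (- (2 * ln (real n)))"
      by simp
    also have "\<dots> = inverse (real n ^ 2)"
      using n by (simp add: exp_minus exp_double)
    finally have "prob (size_bad n) \<le> 2 * inverse (real n ^ 2)"
      using prob_size_deviates[OF \<epsilon>] unfolding size_bad_def by simp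
    moreover have "prob (visits_bad n) \<le> exp (- 1) ^ n"
    proof -
      have "prob (visits_bad n) \<le> exp (real n * (R * (inverse (m n) * real (mixing_time n)) - 2))"
        unfolding visits_bad_def R_def C_def
        by (rule prob_many_visits[OF n mixing_time_le_square[OF n] \<epsilon>(1)])
      also have "\<dots> \<le> exp (real n * (- 1))"
        using elim(1) by (subst exp_le_cancel_iff, intro mult_left_mono) (auto simp: divide_inverse mult_ac)
      also have "\<dots> = exp (- 1) ^ n" by (rule exp_of_nat_mult)
      finally show ?thesis .
    qed
    moreover have "prob (E n) \<le> prob (size_bad n) + prob (visits_bad n)"
      using n events[OF n] unfolding E_def by (simp add: measure_Un_le)
    ultimately show ?case by simp
  qed
  then have "summable (\<lambda>n. prob (E n))"
  proof (rule summable_comparison_test_ev)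
    show "summable (\<lambda>n. 2 * inverse (real n ^ 2) + exp (- 1 :: real) ^ n)"
      by (intro summable_add summable_mult inverse_power_summable summable_geometric) auto
  qed
  moreover have "E n \<in> events" for n using events[of n] by (auto simp: E_def)
  ultimately have "AE \<omega> in P. eventually (\<lambda>n. \<omega> \<in> space P - E n) sequentially"
    by (intro borel_cantelli_AE1) (auto simp: emeasure_eq_measure)
  then show ?thesis
  proof eventually_elim
    case (elim \<omega>)
    then show ?case using eventually_ge_at_top[of 1]
    proof eventually_elim
      case (elim n)
      then show ?case
        by (auto simp: E_def size_bad_def visits_bad_def not_le divide_inverse mult.commute)
    qed
  qed
qed

text \<open>Only countably many almost sure events may be intersected, so the tolerance runs through the
  reciprocals of the positive integers.\<close>

lemma cloud_almost_surely_regular: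
  fixes m :: "nat \<Rightarrow> real" and A :: "nat \<Rightarrow> 'o \<Rightarrow> bool list set"
  assumes m_pos: "\<And>n. n \<ge> 1 \<Longrightarrow> m n > 0"
    and m_lower: "(\<lambda>n. (real n * ln (real n)) / m n) \<longlonglongrightarrow> 0"
    and m_upper: "(\<lambda>n. m n / (2 ^ n * inverse (ln (real n)))) \<longlonglongrightarrow> 0"
    and P: "prob_space P"
    and cloud: "\<And>n. n \<ge> 1 \<Longrightarrow> percolation_cloud P n (inverse (m n)) (A n)"
  shows "AE \<omega> in P. regular_sets m (\<lambda>n. A n \<omega>)"
proof -
  define \<epsilon> where "\<epsilon> j = inverse (real (Suc j))" for j
  have \<epsilon>: "0 < \<epsilon> j" "\<epsilon> j \<le> 1" for j by (auto simp: \<epsilon>_def inverse_le_1_iff)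
  have "AE \<omega> in P. \<forall>j. eventually (\<lambda>n. \<bar>card (A n \<omega>) - 2 ^ n / m n\<bar> < \<epsilon> j * (2 ^ n / m n) \<and>
    (\<forall>z\<in>hypercube n. visits n (A n \<omega>) (mixing_time n) z < \<epsilon> j)) sequentially"
    unfolding AE_all_countable
    by (intro allI eventually_cloud_regular[OF m_pos m_lower m_upper P cloud] \<epsilon>)
  then show ?thesis using AE_space
  proof eventually_elim
    case (elim \<omega>)
    have small: "\<exists>j. \<epsilon> j < r" if "r > 0" for r
      unfolding \<epsilon>_def by (rule reals_Archimedean[OF that])
    show ?case
    proof
      fix n :: nat assume "n \<ge> 1"
      then show "A n \<omega> \<subseteq> hypercube n"
        using percolation_cloud.subset[OF cloud] elim(2) by blast
    next
      show "(\<lambda>n. card (A n \<omega>) * m n / 2 ^ n) \<longlonglongrightarrow> 1"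
      proof (rule tendstoI)
        fix r :: real assume "r > 0"
        then obtain j where j: "\<epsilon> j < r" using small by blast
        from elim(1)[rule_format, of j] eventually_ge_at_top[of 1]
        show "eventually (\<lambda>n. dist (card (A n \<omega>) * m n / 2 ^ n) 1 < r) sequentially"
        proof eventually_elim
          case (elim n)
          have m: "m n / 2 ^ n > 0" using m_pos elim(2) by simp
          have "card (A n \<omega>) * m n / 2 ^ n - 1 = (card (A n \<omega>) - 2 ^ n / m n) * (m n / 2 ^ n)"
            using m_pos[OF elim(2)] by (simp add: field_simps)
          then have "\<bar>card (A n \<omega>) * m n / 2 ^ n - 1\<bar> = \<bar>card (A n \<omega>) - 2 ^ n / m n\<bar> * (m n / 2 ^ n)"
            by (simp only: abs_mult abs_of_pos[OF m])
          also have "\<dots> < \<epsilon> j * (2 ^ n / m n) * (m n / 2 ^ n)"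
            using elim m by (intro mult_strict_right_mono) auto
          also have "\<dots> = \<epsilon> j" using m_pos[OF elim(2)] by simp
          finally show ?case using j by (simp add: dist_real_def)
        qed
      qed
    next
      fix r :: real assume "r > 0"
      then obtain j where j: "\<epsilon> j < r" using small by blast
      from elim(1)[rule_format, of j]
      show "eventually (\<lambda>n. \<forall>z\<in>hypercube n. visits n (A n \<omega>) (mixing_time n) z < r) sequentially"
        by eventually_elim (use j in \<open>auto intro: less_trans\<close>)
    qed (use density_scales[OF m_pos m_lower m_upper] m_pos in auto)
  qed
qed

section \<open>Hitting times of the clouds\<close>

theorem theorem1p1:
  fixes m :: "nat \<Rightarrow> real"
    and P :: "'o measure"
    and A :: "nat \<Rightarrow> 'o \<Rightarrow> bool list set"
    and Q :: "nat \<Rightarrow> bool list \<Rightarrow> 'w measure"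
    and Y :: "nat \<Rightarrow> nat \<Rightarrow> 'w \<Rightarrow> bool list"
    and a :: real
  assumes m_pos: "\<And>n. n \<ge> 1 \<Longrightarrow> m n > 0"
    and m_lower: "(\<lambda>n. (real n * ln (real n)) / m n) \<longlonglongrightarrow> 0"
    and m_upper: "(\<lambda>n. m n / (2 ^ n * inverse (ln (real n)))) \<longlonglongrightarrow> 0"
    and prob_space: "prob_space P"
    and cloud: "\<And>n. n \<ge> 1 \<Longrightarrow> percolation_cloud P n (inverse (m n)) (A n)"
    and walk: "\<And>n x. n \<ge> 1 \<Longrightarrow> x \<in> hypercube n \<Longrightarrow> simple_random_walk (Q n x) n (Y n) x"
    and a_pos: "a > 0"
  shows "AE \<omega> in P.
    (\<lambda>n. MAX x \<in> hypercube n.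
       \<bar>\<P>(w in Q n x. ereal_of_enat (hitting_time (Y n) (A n \<omega> - {x}) w) \<ge> ereal (a * m n))
          - exp (- a)\<bar>) \<longlonglongrightarrow> 0"
proof -
  have "AE \<omega> in P. regular_sets m (\<lambda>n. A n \<omega>)"
    by (rule cloud_almost_surely_regular[OF m_pos m_lower m_upper prob_space cloud])
  then show ?thesis
  proof eventually_elim
    case (elim \<omega>)
    interpret regular_sets m "\<lambda>n. A n \<omega>" by (rule elim)
    show ?case
    proof (rule tendstoI)
      fix r :: real assume r: "r > 0"
      have "eventually (\<lambda>n. \<forall>x\<in>hypercube n.
          \<bar>avoid n (A n \<omega> - {x}) (nat \<lceil>a * m n\<rceil> - 1) x - exp (- a)\<bar> \<le> r / 2) sequentially"
        using r by (intro avoid_limit a_pos) simp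
      then show "eventually (\<lambda>n. dist (MAX x \<in> hypercube n.
          \<bar>\<P>(w in Q n x. ereal_of_enat (hitting_time (Y n) (A n \<omega> - {x}) w) \<ge> ereal (a * m n))
            - exp (- a)\<bar>) 0 < r) sequentially"
        using eventually_ge_at_top[of 1]
      proof eventually_elim
        case (elim n)
        define f where "f x = \<bar>\<P>(w in Q n x. ereal_of_enat (hitting_time (Y n) (A n \<omega> - {x}) w) \<ge> ereal (a * m n))
            - exp (- a)\<bar>" for x
        have f: "0 \<le> f x \<and> f x \<le> r / 2" if "x \<in> hypercube n" for x
        proof -
          interpret simple_random_walk "Q n x" n "Y n" x by (rule walk[OF elim(2) that])
          have "a * m n > 0" using a_pos m_pos[OF elim(2)] by simp
          then show ?thesis
            unfolding f_def using elim(1) that by (subst prob_hitting_time_ge) auto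
        qed
        have "Max (f ` hypercube n) \<in> f ` hypercube n"
          using hypercube_nonempty by (intro Max_in) auto
        then have "0 \<le> Max (f ` hypercube n) \<and> Max (f ` hypercube n) \<le> r / 2" using f by auto
        then show ?case using r unfolding f_def by (simp add: dist_real_def)
      qed
    qed
  qed
qed

end
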